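(* Let $\mathcal{M}$ be an o-minimal expansion of $(\mathbb{R},<)$. Let $(X,\tau)$ be a definable topological space. Then $(X,\tau)$ is definably second-countable if and only if it is second-countable (i.e. $\tau$ has a countable basis).
   Context: "Definable" means definable in the structure $\mathcal{M}=(M,\ldots)$, possibly with parameters (here $M=\mathbb{R}$). A family of sets $\{A_b : b\in B\}$ is definable if there is a formula $\varphi(x,y)$ such that $B\subseteq M^{|y|}$ is definable and $A_b=\{a\in M^{|x|} : \mathcal{M}\models\varphi(a,b)\}$ for every $b\in B$. $\dim$ denotes o-minimal dimension, with $\dim\emptyset=-\infty$. A definable topological space $(X,\tau)$, $X\subseteq M^n$, is a topological space such that there exists a definable family of subsets of $X$ that is a basis for $\tau$. It is definably second-countable if there exists a definable basis $\{U_b : b\in B\}$ for $\tau$ such that, for every $x\in X$ and $b\in B$, if $x\in U_b$ then $\dim\{c\in B : x\in U_c\subseteq U_b\}=\dim B$. *)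

theory Defs
  imports "HOL-Analysis.Analysis"
begin

section \<open>First-order structures and definable sets\<close>

text \<open>
  The function symbols of the language are the elements of \<open>'f\<close>, the relation symbols those
  of \<open>'r\<close>; constants are function symbols of arity 0.  The universe of a structure is all of
  \<open>'a\<close>.  HOL types are nonempty, so a language always has at least one function
  symbol; this is harmless, as a projection, say, can be added to any structure without changing the
  definable sets.
\<close>

record ('f, 'r, 'a) fo_structure =
  fun_arity :: "'f \<Rightarrow> nat"
  rel_arity :: "'r \<Rightarrow> nat"
  fun_interp :: "'f \<Rightarrow> 'a list \<Rightarrow> 'a"
  rel_interp :: "'r \<Rightarrow> 'a list \<Rightarrow> bool"

datatype 'f fo_term =
    TVar nat
  | TApp 'f "'f fo_term list"

datatype ('f, 'r) fo_formula =
    FEq "'f fo_term" "'f fo_term"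
  | FRel 'r "'f fo_term list"
  | FNeg "('f, 'r) fo_formula"
  | FConj "('f, 'r) fo_formula" "('f, 'r) fo_formula"
  | FEx nat "('f, 'r) fo_formula"

primrec wf_term :: "('f, 'r, 'a) fo_structure \<Rightarrow> 'f fo_term \<Rightarrow> bool" where
  "wf_term M (TVar i) \<longleftrightarrow> True"
| "wf_term M (TApp f ts) \<longleftrightarrow> length ts = fun_arity M f \<and> list_all (wf_term M) ts"

primrec wf_formula :: "('f, 'r, 'a) fo_structure \<Rightarrow> ('f, 'r) fo_formula \<Rightarrow> bool" where
  "wf_formula M (FEq s t) \<longleftrightarrow> wf_term M s \<and> wf_term M t"
| "wf_formula M (FRel r ts) \<longleftrightarrow> length ts = rel_arity M r \<and> list_all (wf_term M) ts"
| "wf_formula M (FNeg \<phi>) \<longleftrightarrow> wf_formula M \<phi>"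
| "wf_formula M (FConj \<phi> \<psi>) \<longleftrightarrow> wf_formula M \<phi> \<and> wf_formula M \<psi>"
| "wf_formula M (FEx i \<phi>) \<longleftrightarrow> wf_formula M \<phi>"

primrec eval_term :: "('f, 'r, 'a) fo_structure \<Rightarrow> (nat \<Rightarrow> 'a) \<Rightarrow> 'f fo_term \<Rightarrow> 'a" where
  "eval_term M e (TVar i) = e i"
| "eval_term M e (TApp f ts) = fun_interp M f (map (eval_term M e) ts)"

primrec sat :: "('f, 'r, 'a) fo_structure \<Rightarrow> (nat \<Rightarrow> 'a) \<Rightarrow> ('f, 'r) fo_formula \<Rightarrow> bool" where
  "sat M e (FEq s t) \<longleftrightarrow> eval_term M e s = eval_term M e t"
| "sat M e (FRel r ts) \<longleftrightarrow> rel_interp M r (map (eval_term M e) ts)"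
| "sat M e (FNeg \<phi>) \<longleftrightarrow> \<not> sat M e \<phi>"
| "sat M e (FConj \<phi> \<psi>) \<longleftrightarrow> sat M e \<phi> \<and> sat M e \<psi>"
| "sat M e (FEx i \<phi>) \<longleftrightarrow> (\<exists>v. sat M (e(i := v)) \<phi>)"

text \<open>
  The tuple \<open>xs\<close> is assigned to the variables \<open>0, ..., length xs - 1\<close>, and the parameters
  \<open>p 0, p 1, ...\<close> to the remaining ones.  A formula mentions only finitely many variables, so only
  finitely many parameters matter.
\<close>

definition assign :: "'a list \<Rightarrow> (nat \<Rightarrow> 'a) \<Rightarrow> nat \<Rightarrow> 'a" where
  "assign xs p = (\<lambda>i. if i < length xs then xs ! i else p (i - length xs))"

text \<open>The elements of \<open>M\<^sup>n\<close> are the lists of length \<open>n\<close>.\<close>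

definition tuples :: "nat \<Rightarrow> 'a list set" where
  "tuples n = {xs. length xs = n}"

definition definable :: "('f, 'r, 'a) fo_structure \<Rightarrow> nat \<Rightarrow> 'a list set \<Rightarrow> bool" where
  "definable M n A \<longleftrightarrow>
     (\<exists>\<phi> p. wf_formula M \<phi> \<and> A = {a \<in> tuples n. sat M (assign a p) \<phi>})"

definition definable_family ::
  "('f, 'r, 'a) fo_structure \<Rightarrow> nat \<Rightarrow> nat \<Rightarrow> 'a list set \<Rightarrow> ('a list \<Rightarrow> 'a list set) \<Rightarrow> bool" where
  "definable_family M n m B A \<longleftrightarrow>
     definable M m B \<and>
     (\<exists>\<phi> p. wf_formula M \<phi> \<and>
        (\<forall>b\<in>B. A b = {a \<in> tuples n. sat M (assign (a @ b) p) \<phi>}))"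


section \<open>O-minimal expansions of the real order\<close>

definition expands_real_order :: "('f, 'r, real) fo_structure \<Rightarrow> bool" where
  "expands_real_order M \<longleftrightarrow>
     (\<exists>r. rel_arity M r = 2 \<and> (\<forall>a b. rel_interp M r [a, b] \<longleftrightarrow> a < b))"

text \<open>\<open>einterval a b\<close> is the open interval with endpoints \<open>a\<close> and \<open>b\<close> in \<open>\<real> \<union> {-\<infinity>, \<infinity>}\<close>.\<close>

definition o_minimal_expansion :: "('f, 'r, real) fo_structure \<Rightarrow> bool" where
  "o_minimal_expansion M \<longleftrightarrow>
     expands_real_order M \<and>
     (\<forall>A. definable M 1 ((\<lambda>t. [t]) ` A) \<longrightarrow>
        (\<exists>\<C>. finite \<C> \<and> A = \<Union>\<C> \<and>
           (\<forall>C\<in>\<C>. (\<exists>t. C = {t}) \<or> (\<exists>a b. C = einterval a b))))"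


section \<open>Cells and o-minimal dimension\<close>

definition tuple_topology :: "nat \<Rightarrow> real list topology" where
  "tuple_topology n =
     pullback_topology (tuples n) (\<lambda>xs. restrict (nth xs) {..<n}) (powertop_real {..<n})"

definition definable_continuous ::
  "('f, 'r, real) fo_structure \<Rightarrow> nat \<Rightarrow> real list set \<Rightarrow> (real list \<Rightarrow> real) \<Rightarrow> bool" where
  "definable_continuous M n C f \<longleftrightarrow>
     definable M (Suc n) {x @ [f x] |x. x \<in> C} \<and>
     continuous_map (subtopology (tuple_topology n) C) euclideanreal f"

text \<open>Definable continuous functions on \<open>C\<close>, together with the constant functions \<open>-\<infinity>\<close> and \<open>\<infinity>\<close>.\<close>

definition cell_bound ::
  "('f, 'r, real) fo_structure \<Rightarrow> nat \<Rightarrow> real list set \<Rightarrow> (real list \<Rightarrow> ereal) \<Rightarrow> bool" where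
  "cell_bound M n C f \<longleftrightarrow>
     (\<exists>f'. definable_continuous M n C f' \<and> (\<forall>x\<in>C. f x = ereal (f' x))) \<or>
     (\<forall>x\<in>C. f x = -\<infinity>) \<or> (\<forall>x\<in>C. f x = \<infinity>)"

text \<open>
  \<open>cell M ks C\<close> says that \<open>C\<close> is a \<open>(k\<^sub>1, ..., k\<^sub>m)\<close>-cell, where \<open>ks = [k\<^sub>1, ..., k\<^sub>m]\<close> is a sequence
  of zeros and ones.  The induction starts at the one-point space of 0-tuples; the
  \<open>(0)\<close>-cells are then the points and the \<open>(1)\<close>-cells the nonempty open intervals.
\<close>

inductive cell :: "('f, 'r, real) fo_structure \<Rightarrow> nat list \<Rightarrow> real list set \<Rightarrow> bool" for M where
  point: "cell M [] {[]}"
| graph: "cell M ks C \<Longrightarrow> definable_continuous M (length ks) C f \<Longrightarrow>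
    cell M (ks @ [0]) {x @ [f x] |x. x \<in> C}"
| band: "cell M ks C \<Longrightarrow> cell_bound M (length ks) C f \<Longrightarrow> cell_bound M (length ks) C g \<Longrightarrow>
    \<forall>x\<in>C. f x < g x \<Longrightarrow>
    cell M (ks @ [1]) {x @ [t] |x t. x \<in> C \<and> f x < ereal t \<and> ereal t < g x}"

text \<open>
  The dimension of \<open>A\<close> is the largest \<open>k\<^sub>1 + ... + k\<^sub>m\<close> such that \<open>A\<close> contains a
  \<open>(k\<^sub>1, ..., k\<^sub>m)\<close>-cell.  In \<open>ereal\<close> the supremum of the empty set is \<open>-\<infinity>\<close>.
\<close>

definition odim :: "('f, 'r, real) fo_structure \<Rightarrow> real list set \<Rightarrow> ereal" where
  "odim M A = (SUP ks \<in> {ks. \<exists>C. cell M ks C \<and> C \<subseteq> A}. ereal (real (sum_list ks)))"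

lemma cell_nonempty: "cell M ks C \<Longrightarrow> C \<noteq> {}"
proof (induction rule: cell.induct)
  case (band ks C f g)
  then obtain x where "x \<in> C" by blast
  moreover from this band obtain t where "f x < ereal t" "ereal t < g x"
    using ereal_dense2 by blast
  ultimately show ?case by blast
qed auto

lemma odim_empty: "odim M {} = -\<infinity>"
proof -
  have "{ks. \<exists>C. cell M ks C \<and> C \<subseteq> {}} = {}"
    using cell_nonempty by fastforce
  then show ?thesis
    unfolding odim_def by (simp only: image_empty Sup_empty bot_ereal_def)
qed


section \<open>Definable topological spaces\<close>

text \<open>The underlying set of the space is \<open>topspace T\<close>, and \<open>T\<close> is its topology.\<close>

definition basis_for :: "'a topology \<Rightarrow> 'a set set \<Rightarrow> bool" where
  "basis_for T \<B> \<longleftrightarrow>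
     (\<forall>V\<in>\<B>. openin T V) \<and>
     (\<forall>W x. openin T W \<and> x \<in> W \<longrightarrow> (\<exists>V\<in>\<B>. x \<in> V \<and> V \<subseteq> W))"

definition definable_basis ::
  "('f, 'r, 'a) fo_structure \<Rightarrow> nat \<Rightarrow> 'a list topology \<Rightarrow>
     nat \<Rightarrow> 'a list set \<Rightarrow> ('a list \<Rightarrow> 'a list set) \<Rightarrow> bool" where
  "definable_basis M n T m B U \<longleftrightarrow> definable_family M n m B U \<and> basis_for T (U ` B)"

definition definable_topological_space ::
  "('f, 'r, 'a) fo_structure \<Rightarrow> nat \<Rightarrow> 'a list topology \<Rightarrow> bool" where
  "definable_topological_space M n T \<longleftrightarrow>
     topspace T \<subseteq> tuples n \<and> (\<exists>m B U. definable_basis M n T m B U)"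

definition definably_second_countable ::
  "('f, 'r, real) fo_structure \<Rightarrow> nat \<Rightarrow> real list topology \<Rightarrow> bool" where
  "definably_second_countable M n T \<longleftrightarrow>
     (\<exists>m B U. definable_basis M n T m B U \<and>
        (\<forall>x\<in>topspace T. \<forall>b\<in>B. x \<in> U b \<longrightarrow>
           odim M {c \<in> B. x \<in> U c \<and> U c \<subseteq> U b} = odim M B))"

end

theory Submission
  imports Defs
begin

text \<open>
  Dimension is handled through a predicate \<open>dim_ge m k A\<close> that peels off first coordinates and asks
  for uncountably many big fibres.  For arbitrary sets it is a \<open>\<sigma>\<close>-ideal condition that is additive
  over fibres; o-minimality is needed only to make it definable in families (an uncountable
  definable subset of the line contains an interval) and to compare it with the dimension by cells.
  For the latter, a definable function on a cell is continuous off a small set, since its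
  preimages of rational intervals are relatively open up to small sets.

  If \<open>B\<close> indexes a basis as in the definition of definable second countability, some countable
  \<open>D \<subseteq> B\<close> meets every definable subset of full dimension, so \<open>D\<close> indexes a countable basis.

  Conversely, let \<open>A(z,b) = {c \<in> B. z \<in> U\<^sub>c \<subseteq> U\<^sub>b}\<close>, let \<open>k\<close> be the least dimension of \<open>A(z,b)\<close>
  over all \<open>b\<close>, and let \<open>G\<^sub>z\<close> be the set of \<open>b\<close> where it is attained.  On a definable set \<open>Z\<close> of points
  where \<open>k\<close> and \<open>dim G\<^sub>z\<close> are constant, index the neighbourhoods \<open>U\<^sub>c\<close> by the triples \<open>(z, b, c)\<close> with
  \<open>z \<in> Z\<close>, \<open>b \<in> G\<^sub>z\<close>, \<open>c \<in> A(z,b)\<close>.  If the points of \<open>Z\<close> at which this family is not of full dimension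
  had dimension \<open>dim Z\<close>, then so would those that are bad for one fixed member \<open>U\<^sub>b\<close> of a countable
  basis; the triples over these with \<open>U\<^sub>c \<subseteq> U\<^sub>b\<close> have full dimension, hence so do those with
  \<open>z \<in> U\<^sub>c\<^sub>' \<subseteq> U\<^sub>c\<close> for one fixed basic \<open>U\<^sub>c\<^sub>'\<close>, and these show that \<open>z\<close> was not bad.  So the bad points
  have smaller dimension, and induction on the dimension covers the space by finitely many families.
\<close>

section \<open>Dimension by uncountable fibres\<close>

text \<open>Only members of \<open>A\<close> of length \<open>m\<close> count. Asking for
  uncountably many fibres, rather than an interval of them, gives a condition that makes sense for
  arbitrary sets and survives countable unions.\<close>

primrec dim_ge :: "nat \<Rightarrow> nat \<Rightarrow> real list set \<Rightarrow> bool" where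
  "dim_ge 0 k A \<longleftrightarrow> k = 0 \<and> [] \<in> A"
| "dim_ge (Suc m) k A \<longleftrightarrow>
     (\<exists>t. dim_ge m k {xs. t # xs \<in> A}) \<or>
     (\<exists>j. k = Suc j \<and> uncountable {t. dim_ge m j {xs. t # xs \<in> A}})"

lemma dim_ge_mono: "dim_ge m k A \<Longrightarrow> A \<subseteq> B \<Longrightarrow> dim_ge m k B"
proof (induction m arbitrary: k A B)
  case (Suc m)
  have sub: "{xs. t # xs \<in> A} \<subseteq> {xs. t # xs \<in> B}" for t
    using Suc.prems(2) by auto
  have "{t. dim_ge m j {xs. t # xs \<in> A}} \<subseteq> {t. dim_ge m j {xs. t # xs \<in> B}}" for j
    using Suc.IH sub by blast
  then have "uncountable {t. dim_ge m j {xs. t # xs \<in> A}} \<Longrightarrow>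
      uncountable {t. dim_ge m j {xs. t # xs \<in> B}}" for j
    using countable_subset by blast
  then show ?case
    using Suc.prems(1) Suc.IH[OF _ sub] by auto
qed auto

text \<open>Fibres commute with unions, so in the inductive step an uncountable set of first
  coordinates is covered by countably many sets, one for each \<open>i\<close>, and one of these is
  uncountable. This is the pigeonhole principle behind all later uses of countability.\<close>

lemma dim_ge_UN:
  assumes "countable I" "dim_ge m k (\<Union>i\<in>I. A i)"
  shows "\<exists>i\<in>I. dim_ge m k (A i)"
  using assms(2)
proof (induction m arbitrary: k A)
  case (Suc m)
  have eq: "{xs. t # xs \<in> (\<Union>i\<in>I. A i)} = (\<Union>i\<in>I. {xs. t # xs \<in> A i})" for t
    by auto
  from Suc.prems consider t where "dim_ge m k (\<Union>i\<in>I. {xs. t # xs \<in> A i})"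
    | j where "k = Suc j" "uncountable {t. dim_ge m j (\<Union>i\<in>I. {xs. t # xs \<in> A i})}"
    unfolding dim_ge.simps eq by blast
  then show ?case
  proof cases
    case 1
    then show ?thesis
      using Suc.IH by fastforce
  next
    case 2
    have "{t. dim_ge m j (\<Union>i\<in>I. {xs. t # xs \<in> A i})}
        \<subseteq> (\<Union>i\<in>I. {t. dim_ge m j {xs. t # xs \<in> A i}})"
      using Suc.IH by fast
    then have "uncountable (\<Union>i\<in>I. {t. dim_ge m j {xs. t # xs \<in> A i}})"
      using 2(2) countable_subset by blast
    then have "\<exists>i\<in>I. uncountable {t. dim_ge m j {xs. t # xs \<in> A i}}"
      by (metis (mono_tags, lifting) assms(1) countable_UN)
    then show ?thesis
      using 2(1) by auto
  qed
qed auto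

lemma dim_ge_Un:
  assumes "dim_ge m k (A \<union> B)"
  shows "dim_ge m k A \<or> dim_ge m k B"
proof -
  have "A \<union> B = (\<Union>S\<in>{A, B}. S)"
    by simp
  then have "dim_ge m k (\<Union>S\<in>{A, B}. S)"
    using assms by simp
  then have "\<exists>S\<in>{A, B}. dim_ge m k S"
    by (rule dim_ge_UN[rotated]) simp
  then show ?thesis
    by blast
qed

lemma dim_ge_SucD: "dim_ge m (Suc k) A \<Longrightarrow> dim_ge m k A"
proof (induction m arbitrary: k A)
  case (Suc m)
  show ?case
  proof (cases "\<exists>t. dim_ge m (Suc k) {xs. t # xs \<in> A}")
    case True
    then show ?thesis
      using Suc.IH by auto
  next
    case False
    then have "uncountable {t. dim_ge m k {xs. t # xs \<in> A}}"
      using Suc.prems by simp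
    then have "\<exists>t. dim_ge m k {xs. t # xs \<in> A}"
      by (metis (no_types, lifting) Collect_empty_eq countable_empty)
    then show ?thesis
      by simp
  qed
qed simp

lemma dim_ge_antimono: "dim_ge m k A \<Longrightarrow> j \<le> k \<Longrightarrow> dim_ge m j A"
  by (induction k) (auto simp: le_Suc_eq dest: dim_ge_SucD)

lemma dim_ge_le: "dim_ge m k A \<Longrightarrow> k \<le> m"
proof (induction m arbitrary: k A)
  case (Suc m)
  then have "dim_ge m (k - 1) {xs. t # xs \<in> A} \<Longrightarrow> k - 1 \<le> m" for t
    by blast
  moreover have "\<exists>t. dim_ge m (k - 1) {xs. t # xs \<in> A}"
  proof (cases "\<exists>t. dim_ge m k {xs. t # xs \<in> A}")
    case True
    then show ?thesis
      using dim_ge_antimono diff_le_self by blast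
  next
    case False
    then obtain j where "k = Suc j" "uncountable {t. dim_ge m j {xs. t # xs \<in> A}}"
      using Suc.prems by auto
    then show ?thesis
      by (metis (no_types, lifting) Collect_empty_eq countable_empty diff_Suc_1)
  qed
  ultimately have "k - 1 \<le> m"
    by blast
  then show ?case
    by linarith
qed simp

lemma dim_ge_0: "dim_ge m 0 A \<longleftrightarrow> (\<exists>xs\<in>A. length xs = m)"
proof (induction m arbitrary: A)
  case (Suc m)
  show ?case
    by (auto simp: Suc.IH length_Suc_conv) 
qed simp

lemma dim_ge_nonempty: "dim_ge m k A \<Longrightarrow> \<exists>xs\<in>A. length xs = m"
  using dim_ge_0 dim_ge_antimono by blast

text \<open>Lower half of the additivity over fibres. The induction peels off the coordinates of the
  base point, so that the slice of \<open>W\<close> at \<open>t\<close> lies over the slice of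
  \<open>Y\<close> at \<open>t\<close>.\<close>

lemma dim_ge_superadditive:
  assumes "dim_ge n d Y" "\<And>z. z \<in> Y \<Longrightarrow> length z = n \<Longrightarrow> dim_ge m e {w. z @ w \<in> W}"
  shows "dim_ge (n + m) (d + e) W"
  using assms
proof (induction n arbitrary: d Y W)
  case 0
  then show ?case by auto
next
  case (Suc n)
  have *: "dim_ge (n + m) (j + e) {xs. t # xs \<in> W}" if "dim_ge n j {xs. t # xs \<in> Y}" for t j
    using Suc.IH[OF that, of "{xs. t # xs \<in> W}"] Suc.prems(2)[of "t # _"] by auto
  show ?case
  proof (cases "\<exists>t. dim_ge n d {xs. t # xs \<in> Y}")
    case True
    then show ?thesis
      using * by auto
  next
    case False
    then obtain j where j: "d = Suc j" "uncountable {t. dim_ge n j {xs. t # xs \<in> Y}}"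
      using Suc.prems by auto
    have "{t. dim_ge n j {xs. t # xs \<in> Y}} \<subseteq> {t. dim_ge (n + m) (j + e) {xs. t # xs \<in> W}}"
      using * by blast
    then show ?thesis
      using j countable_subset by auto
  qed
qed

text \<open>Upper half of the additivity over fibres: if \<open>Y\<close> contains the projection of
  \<open>W\<close> and the fibres over \<open>Y\<close> have dimension at most \<open>e\<close>,
  then whatever \<open>W\<close> has beyond \<open>e\<close> comes from \<open>Y\<close>.\<close>

lemma dim_ge_subadditive:
  assumes "dim_ge (n + m) (d + e) W"
    and "\<And>z w. length z = n \<Longrightarrow> length w = m \<Longrightarrow> z @ w \<in> W \<Longrightarrow> z \<in> Y"
    and "\<And>z. z \<in> Y \<Longrightarrow> length z = n \<Longrightarrow> \<not> dim_ge m (Suc e) {w. z @ w \<in> W}"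
  shows "dim_ge n d Y"
  using assms
proof (induction n arbitrary: d Y W)
  case 0
  then have W: "dim_ge m (d + e) W"
    by simp
  have Y: "[] \<in> Y"
    using dim_ge_nonempty[OF W] 0(2)[of "[]"] by auto
  \<comment> \<open>The base is the one-point space, so \<open>W\<close> is its own fibre over
    \<open>[]\<close> and has dimension at most \<open>e\<close>.\<close>
  have "d = 0"
  proof (rule ccontr)
    assume "d \<noteq> 0"
    then have "dim_ge m (Suc e) W"
      using W dim_ge_antimono by force
    then show False
      using 0(3)[OF Y] by simp
  qed
  with Y show ?case
    by simp
next
  case (Suc n)
  have *: "dim_ge n j {xs. t # xs \<in> Y}" if "dim_ge (n + m) (j + e) {xs. t # xs \<in> W}" for t j
    using that by (rule Suc.IH) (use Suc.prems(2)[of "t # _"] Suc.prems(3)[of "t # _"] in auto)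
  show ?case
  proof (cases d)
    case 0
    obtain w where "w \<in> W" "length w = Suc n + m"
      using dim_ge_nonempty[OF Suc.prems(1)] by blast
    then have "take (Suc n) w \<in> Y" "length (take (Suc n) w) = Suc n"
      using Suc.prems(2)[of "take (Suc n) w" "drop (Suc n) w"] by auto
    then show ?thesis
      using 0 dim_ge_0 by blast
  next
    case (Suc d')
    show ?thesis
    proof (cases "\<exists>t. dim_ge (n + m) (d + e) {xs. t # xs \<in> W}")
      case True
      then show ?thesis
        using * by auto
    next
      case False
      then have "uncountable {t. dim_ge (n + m) (d' + e) {xs. t # xs \<in> W}}"
        using Suc.prems(1) Suc by auto
      moreover have "{t. dim_ge (n + m) (d' + e) {xs. t # xs \<in> W}}
          \<subseteq> {t. dim_ge n d' {xs. t # xs \<in> Y}}"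
        using * by blast
      ultimately show ?thesis
        using Suc countable_subset by auto
    qed
  qed
qed

lemma dim_ge_1: "dim_ge (Suc 0) k S \<longleftrightarrow>
    (k = 0 \<and> (\<exists>t. [t] \<in> S)) \<or> (k = Suc 0 \<and> uncountable {t. [t] \<in> S})"
proof (cases "k = Suc 0")
  case True
  then show ?thesis
    by simp
next
  case False
  then show ?thesis
    by (cases "k = 0") auto
qed

text \<open>\<open>dim_ge\<close> peels off first coordinates, whereas cells grow by a last
  coordinate; this lemma passes from one to the other. Split \<open>E\<close> by whether the fibre
  in the last coordinate is countable and apply subadditivity with fibre dimension 0 or 1.\<close>

lemma dim_ge_last:
  assumes "dim_ge (Suc m) (Suc k) E"
  shows "dim_ge m (Suc k) {x. countable {t. x @ [t] \<in> E} \<and> (\<exists>t. x @ [t] \<in> E)} \<or>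
    dim_ge m k {x. uncountable {t. x @ [t] \<in> E}}"
proof -
  define C U where "C = {x. countable {t. x @ [t] \<in> E} \<and> (\<exists>t. x @ [t] \<in> E)}"
    and "U = {x. uncountable {t. x @ [t] \<in> E}}"
  define EC EU where "EC = {w \<in> E. butlast w \<in> C}" and "EU = {w \<in> E. butlast w \<in> U}"
  \<comment> \<open>The empty list has no last coordinate to split off; it is set aside and, having
    the wrong length, has no influence on the dimension.\<close>
  have "E \<subseteq> (EC \<union> EU) \<union> {[]}"
  proof
    fix w assume w: "w \<in> E"
    show "w \<in> (EC \<union> EU) \<union> {[]}"
    proof (cases w rule: rev_cases)
      case (snoc x t)
      then have "x \<in> C \<or> x \<in> U"
        using w unfolding C_def U_def mem_Collect_eq by metis
      then show ?thesis
        using w snoc by (auto simp: EC_def EU_def)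
    qed simp
  qed
  then have "dim_ge (Suc m) (Suc k) ((EC \<union> EU) \<union> {[]})"
    by (rule dim_ge_mono[OF assms])
  moreover have "\<not> dim_ge (Suc m) (Suc k) {[]}"
    by (auto simp del: dim_ge.simps dest!: dim_ge_nonempty)
  ultimately have "dim_ge (Suc m) (Suc k) (EC \<union> EU)"
    using dim_ge_Un by blast
  then have "dim_ge (m + Suc 0) (Suc k + 0) EC \<or> dim_ge (m + Suc 0) (k + Suc 0) EU"
    unfolding add_Suc_right add_0_right by (rule dim_ge_Un)
  then have "dim_ge m (Suc k) C \<or> dim_ge m k U"
  proof (elim disj_forward)
    assume "dim_ge (m + Suc 0) (Suc k + 0) EC"
    then show "dim_ge m (Suc k) C"
    proof (rule dim_ge_subadditive)
      fix z w :: "real list"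
      assume "z @ w \<in> EC" "length w = Suc 0"
      then show "z \<in> C"
        by (auto simp: length_Suc_conv EC_def)
    next
      fix z assume "z \<in> C"
      then have "countable {t. z @ [t] \<in> EC}"
        by (simp add: C_def EC_def)
      then show "\<not> dim_ge (Suc 0) (Suc 0) {w. z @ w \<in> EC}"
        unfolding dim_ge_1 by simp
    qed
  next
    assume "dim_ge (m + Suc 0) (k + Suc 0) EU"
    then show "dim_ge m k U"
    proof (rule dim_ge_subadditive)
      fix z w :: "real list"
      assume "z @ w \<in> EU" "length w = Suc 0"
      then show "z \<in> U"
        by (auto simp: length_Suc_conv EU_def)
    next
      fix z show "\<not> dim_ge (Suc 0) (Suc (Suc 0)) {w. z @ w \<in> EU}"
        unfolding dim_ge_1 by simp
    qed
  qed
  then show ?thesis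
    unfolding C_def U_def .
qed

section \<open>A calculus of definable predicates\<close>

primrec rename_term :: "(nat \<Rightarrow> nat) \<Rightarrow> 'f fo_term \<Rightarrow> 'f fo_term" where
  "rename_term \<sigma> (TVar i) = TVar (\<sigma> i)"
| "rename_term \<sigma> (TApp f ts) = TApp f (map (rename_term \<sigma>) ts)"

lemma wf_rename_term: "wf_term M (rename_term \<sigma> t) \<longleftrightarrow> wf_term M t"
  by (induction t) (auto simp: list_all_iff)

lemma eval_rename_term: "eval_term M e (rename_term \<sigma> t) = eval_term M (\<lambda>i. e (\<sigma> i)) t"
  by (induction t) (auto simp: comp_def cong: map_cong)

lemma eval_rename_terms:
  "map (eval_term M e) (map (rename_term \<sigma>) ts) = map (eval_term M (\<lambda>i. e (\<sigma> i))) ts"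
  by (simp add: eval_rename_term)

lemma finite_bound:
  assumes "finite A" "\<And>x. x \<in> A \<Longrightarrow> \<exists>N::nat. P x N" "\<And>x N N'. P x N \<Longrightarrow> N \<le> N' \<Longrightarrow> P x N'"
  shows "\<exists>N. \<forall>x\<in>A. P x N"
proof -
  obtain N where N: "\<And>x. x \<in> A \<Longrightarrow> P x (N x)"
    using assms(2) by metis
  have "P x (Max (N ` A))" if "x \<in> A" for x
    using N[OF that] assms(3) Max_ge[of "N ` A" "N x"] assms(1) that by blast
  then show ?thesis
    by blast
qed

lemma eval_term_support: "\<exists>N. \<forall>e e'. (\<forall>i<N. e i = e' i) \<longrightarrow> eval_term M e t = eval_term M e' t"
proof (induction t)
  case (TVar i)
  then show ?case
    by (intro exI[of _ "Suc i"]) auto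
next
  case (TApp f ts)
  have "\<exists>N. \<forall>t\<in>set ts. \<forall>e e'. (\<forall>i<N. e i = e' i) \<longrightarrow> eval_term M e t = eval_term M e' t"
    using TApp by (intro finite_bound) auto
  then obtain N where N: "\<And>t e e'. t \<in> set ts \<Longrightarrow> (\<forall>i<N. e i = e' i) \<Longrightarrow>
      eval_term M e t = eval_term M e' t"
    by blast
  have "eval_term M e (TApp f ts) = eval_term M e' (TApp f ts)" if "\<forall>i<N. e i = e' i" for e e'
    using N[OF _ that] by (auto cong: map_cong)
  then show ?case
    by blast
qed

lemma eval_terms_support:
  "\<exists>N. \<forall>e e'. (\<forall>i<N. e i = e' i) \<longrightarrow> map (eval_term M e) ts = map (eval_term M e') ts"
proof -
  have "\<exists>N. \<forall>t\<in>set ts. \<forall>e e'. (\<forall>i<N. e i = e' i) \<longrightarrow> eval_term M e t = eval_term M e' t"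
    using eval_term_support by (intro finite_bound) auto
  then obtain N where N: "\<And>t e e'. t \<in> set ts \<Longrightarrow> (\<forall>i<N. e i = e' i) \<Longrightarrow>
      eval_term M e t = eval_term M e' t"
    by blast
  then have "map (eval_term M e) ts = map (eval_term M e') ts" if "\<forall>i<N. e i = e' i" for e e'
    using that by (auto intro: map_cong)
  then show ?thesis
    by blast
qed

text \<open>Only finitely many variables matter to a formula; renaming uses this to find a fresh
  bound variable.\<close>

lemma sat_support: "\<exists>N. \<forall>e e'. (\<forall>i<N. e i = e' i) \<longrightarrow> sat M e \<phi> = sat M e' \<phi>"
proof (induction \<phi>)
  case (FEq s t)
  obtain N where N: "\<And>e e'. (\<forall>i<N. e i = e' i) \<Longrightarrow>
      map (eval_term M e) [s, t] = map (eval_term M e') [s, t]"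
    using eval_terms_support by blast
  then have "sat M e (FEq s t) = sat M e' (FEq s t)" if "\<forall>i<N. e i = e' i" for e e'
    using N[OF that] by simp
  then show ?case
    by blast
next
  case (FRel r ts)
  obtain N where "\<And>e e'. (\<forall>i<N. e i = e' i) \<Longrightarrow>
      map (eval_term M e) ts = map (eval_term M e') ts"
    using eval_terms_support by blast
  then have "sat M e (FRel r ts) = sat M e' (FRel r ts)" if "\<forall>i<N. e i = e' i" for e e'
    using that unfolding sat.simps by metis
  then show ?case
    by blast
next
  case (FNeg \<phi>)
  then show ?case
    by simp
next
  case (FConj \<phi> \<psi>)
  then obtain N N' where
    N: "\<And>e e'. (\<forall>i<N. e i = e' i) \<Longrightarrow> sat M e \<phi> = sat M e' \<phi>" and
    N': "\<And>e e'. (\<forall>i<N'. e i = e' i) \<Longrightarrow> sat M e \<psi> = sat M e' \<psi>"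
    by blast
  have "sat M e (FConj \<phi> \<psi>) = sat M e' (FConj \<phi> \<psi>)" if "\<forall>i<max N N'. e i = e' i" for e e'
  proof -
    have "sat M e \<phi> = sat M e' \<phi>"
      by (rule N) (simp add: that)
    moreover have "sat M e \<psi> = sat M e' \<psi>"
      by (rule N') (simp add: that)
    ultimately show ?thesis
      by simp
  qed
  then show ?case
    by blast
next
  case (FEx i \<phi>)
  then obtain N where N: "\<And>e e'. (\<forall>i<N. e i = e' i) \<Longrightarrow> sat M e \<phi> = sat M e' \<phi>"
    by blast
  have "sat M e (FEx i \<phi>) = sat M e' (FEx i \<phi>)" if "\<forall>i<N. e i = e' i" for e e'
  proof -
    have "sat M (e(i := v)) \<phi> = sat M (e'(i := v)) \<phi>" for v
      by (rule N) (simp add: that)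
    then show ?thesis
      by simp
  qed
  then show ?case
    by blast
qed

text \<open>The new name \<open>k\<close> of a bound variable has to avoid the images under \<open>\<sigma>\<close> of all
  variables that matter, since \<open>\<sigma>\<close> need not be injective.\<close>

lemma rename_formula:
  "wf_formula M \<phi> \<Longrightarrow> \<exists>\<psi>. wf_formula M \<psi> \<and> (\<forall>e. sat M e \<psi> \<longleftrightarrow> sat M (\<lambda>i. e (\<sigma> i)) \<phi>)"
proof (induction \<phi> arbitrary: \<sigma>)
  case (FEq s t)
  then show ?case
    by (intro exI[of _ "FEq (rename_term \<sigma> s) (rename_term \<sigma> t)"])
      (simp add: eval_rename_term wf_rename_term)
next
  case (FRel r ts)
  then show ?case
    by (intro exI[of _ "FRel r (map (rename_term \<sigma>) ts)"])
      (simp add: eval_rename_terms wf_rename_term list_all_iff del: map_map)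
next
  case (FNeg \<phi>)
  then obtain \<psi> where "wf_formula M \<psi>" "\<And>e. sat M e \<psi> \<longleftrightarrow> sat M (\<lambda>i. e (\<sigma> i)) \<phi>"
    by (metis wf_formula.simps(3))
  then show ?case
    by (intro exI[of _ "FNeg \<psi>"]) simp
next
  case (FConj \<phi>1 \<phi>2)
  obtain \<psi>1 where "wf_formula M \<psi>1" "\<And>e. sat M e \<psi>1 \<longleftrightarrow> sat M (\<lambda>i. e (\<sigma> i)) \<phi>1"
    using FConj by (metis wf_formula.simps(4))
  moreover obtain \<psi>2 where "wf_formula M \<psi>2" "\<And>e. sat M e \<psi>2 \<longleftrightarrow> sat M (\<lambda>i. e (\<sigma> i)) \<phi>2"
    using FConj by (metis wf_formula.simps(4))
  ultimately show ?case
    by (intro exI[of _ "FConj \<psi>1 \<psi>2"]) simp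
next
  case (FEx i \<phi>)
  obtain N where N: "\<And>e e'. (\<forall>i<N. e i = e' i) \<Longrightarrow> sat M e \<phi> = sat M e' \<phi>"
    using sat_support by blast
  obtain k where k: "k \<notin> \<sigma> ` {..<N}"
    using ex_new_if_finite[OF infinite_UNIV_nat] by (metis finite_imageI finite_lessThan)
  obtain \<psi> where \<psi>: "wf_formula M \<psi>" "\<And>e. sat M e \<psi> \<longleftrightarrow> sat M (\<lambda>j. e ((\<sigma>(i := k)) j)) \<phi>"
    using FEx by (metis wf_formula.simps(5))
  have "sat M (e(k := v)) \<psi> \<longleftrightarrow> sat M ((\<lambda>j. e (\<sigma> j))(i := v)) \<phi>" for e v
    unfolding \<psi>(2) using k by (intro N) auto
  then show ?case
    using \<psi>(1) by (intro exI[of _ "FEx k \<psi>"]) simp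
qed

text \<open>A variable of a formula denotes a coordinate of the environment or a parameter.\<close>

abbreviation val :: "(nat \<Rightarrow> 'a) \<Rightarrow> nat + 'a \<Rightarrow> 'a" where
  "val e \<equiv> case_sum e id"

text \<open>Since \<open>s\<close> may send each variable to any coordinate or parameter,
  substituting coordinates or constants changes only \<open>s\<close> and not the formula.\<close>

definition definable_pred :: "('f, 'r, 'a) fo_structure \<Rightarrow> ((nat \<Rightarrow> 'a) \<Rightarrow> bool) \<Rightarrow> bool" where
  "definable_pred M P \<longleftrightarrow>
     (\<exists>\<phi> s. wf_formula M \<phi> \<and> (\<forall>e. P e \<longleftrightarrow> sat M (\<lambda>i. val e (s i)) \<phi>))"

lemma definable_predI:
  "wf_formula M \<phi> \<Longrightarrow> (\<And>e. P e \<longleftrightarrow> sat M (\<lambda>i. val e (s i)) \<phi>) \<Longrightarrow> definable_pred M P"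
  unfolding definable_pred_def by (rule exI[of _ \<phi>], rule exI[of _ s]) simp

lemma definable_predE:
  assumes "definable_pred M P"
  obtains \<phi> s where "wf_formula M \<phi>" "\<And>e. P e \<longleftrightarrow> sat M (\<lambda>i. val e (s i)) \<phi>"
proof -
  from assms obtain \<phi> s where *: "wf_formula M \<phi> \<and> (\<forall>e. P e \<longleftrightarrow> sat M (\<lambda>i. val e (s i)) \<phi>)"
    unfolding definable_pred_def by (elim exE)
  show thesis
    by (rule that[OF conjunct1[OF *] spec[OF conjunct2[OF *]]])
qed

text \<open>Coordinates and constants suffice as terms: the function symbols of the language enter
  only through the formulas that define given sets.\<close>

definition simple_term :: "((nat \<Rightarrow> 'a) \<Rightarrow> 'a) \<Rightarrow> bool" where
  "simple_term T \<longleftrightarrow> (\<exists>u. T = (\<lambda>e. val e u))"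

definition simple_terms :: "((nat \<Rightarrow> 'a) \<Rightarrow> 'a list) \<Rightarrow> bool" where
  "simple_terms T \<longleftrightarrow> (\<exists>us. T = (\<lambda>e. map (val e) us))"

named_theorems definable_intros

lemma simple_term_var [definable_intros]: "simple_term (\<lambda>e. e i)"
  unfolding simple_term_def by (rule exI[of _ "Inl i"]) simp

lemma simple_term_const [definable_intros]: "simple_term (\<lambda>e. c)"
  unfolding simple_term_def by (rule exI[of _ "Inr c"]) simp

lemma simple_terms_Nil [definable_intros]: "simple_terms (\<lambda>e. [])"
  unfolding simple_terms_def by (intro exI[of _ "[]"]) simp

lemma simple_terms_Cons [definable_intros]:
  assumes "simple_term S" "simple_terms T"
  shows "simple_terms (\<lambda>e. S e # T e)"
proof -
  obtain u us where "S = (\<lambda>e. val e u)" "T = (\<lambda>e. map (val e) us)"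
    using assms unfolding simple_term_def simple_terms_def by blast
  then show ?thesis
    unfolding simple_terms_def by (intro exI[of _ "u # us"]) simp
qed

lemma simple_terms_append [definable_intros]:
  assumes "simple_terms S" "simple_terms T"
  shows "simple_terms (\<lambda>e. S e @ T e)"
proof -
  obtain us vs where "S = (\<lambda>e. map (val e) us)" "T = (\<lambda>e. map (val e) vs)"
    using assms unfolding simple_terms_def by blast
  then show ?thesis
    unfolding simple_terms_def by (intro exI[of _ "us @ vs"]) simp
qed

lemma simple_terms_take [definable_intros]:
  assumes "simple_terms T"
  shows "simple_terms (\<lambda>e. take j (T e))"
proof -
  obtain us where "T = (\<lambda>e. map (val e) us)"
    using assms unfolding simple_terms_def by blast
  then show ?thesis
    unfolding simple_terms_def by (intro exI[of _ "take j us"]) (simp add: take_map)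
qed

lemma simple_terms_drop [definable_intros]:
  assumes "simple_terms T"
  shows "simple_terms (\<lambda>e. drop j (T e))"
proof -
  obtain us where "T = (\<lambda>e. map (val e) us)"
    using assms unfolding simple_terms_def by blast
  then show ?thesis
    unfolding simple_terms_def by (intro exI[of _ "drop j us"]) (simp add: drop_map)
qed

lemma simple_terms_map [definable_intros]: "simple_terms (\<lambda>e. map (\<lambda>i. e (g i)) xs)"
  unfolding simple_terms_def by (intro exI[of _ "map (\<lambda>i. Inl (g i)) xs"]) (simp add: comp_def)

text \<open>The eta-contracted instance, which matching in \<open>intro\<close> does not find.\<close>

lemma simple_terms_map_id [definable_intros]: "simple_terms (\<lambda>e. map e xs)"
  using simple_terms_map[of "\<lambda>i. i" xs] by simp

lemma simple_terms_const [definable_intros]: "simple_terms (\<lambda>e. xs)"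
  unfolding simple_terms_def by (intro exI[of _ "map Inr xs"]) (simp add: comp_def)

section \<open>Closure under connectives, quantifiers and membership\<close>

lemma definable_pred_subst:
  assumes "definable_pred M P"
  shows "definable_pred M (\<lambda>e. P (\<lambda>i. val e (u i)))"
proof -
  obtain \<phi> s where "wf_formula M \<phi>" and \<phi>: "\<And>e. P e \<longleftrightarrow> sat M (\<lambda>i. val e (s i)) \<phi>"
    using assms by (rule definable_predE) (rule that)
  have "val (\<lambda>i. val e (u i)) (s i) = val e (case_sum u Inr (s i))" for e i
    by (simp split: sum.split)
  then have "P (\<lambda>i. val e (u i)) \<longleftrightarrow> sat M (\<lambda>i. val e (case_sum u Inr (s i))) \<phi>" for e
    unfolding \<phi> by simp
  with \<open>wf_formula M \<phi>\<close> show ?thesis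
    by (rule definable_predI)
qed

lemma definable_pred_Not [definable_intros]:
  assumes "definable_pred M P"
  shows "definable_pred M (\<lambda>e. \<not> P e)"
proof -
  obtain \<phi> s where \<phi>: "wf_formula M \<phi>" "\<And>e. P e \<longleftrightarrow> sat M (\<lambda>i. val e (s i)) \<phi>"
    using assms by (rule definable_predE) (rule that)
  show ?thesis
    by (rule definable_predI[of M "FNeg \<phi>" _ s]) (simp_all add: \<phi>)
qed

lemma definable_pred_conj [definable_intros]:
  assumes "definable_pred M P" "definable_pred M Q"
  shows "definable_pred M (\<lambda>e. P e \<and> Q e)"
proof -
  obtain \<phi> s where \<phi>: "wf_formula M \<phi>" "\<And>e. P e \<longleftrightarrow> sat M (\<lambda>i. val e (s i)) \<phi>"
    using assms(1) by (rule definable_predE) (rule that)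
  obtain \<psi> t where \<psi>: "wf_formula M \<psi>" "\<And>e. Q e \<longleftrightarrow> sat M (\<lambda>i. val e (t i)) \<psi>"
    using assms(2) by (rule definable_predE) (rule that)
  \<comment> \<open>The two formulas read their variables through different maps \<open>s\<close>
    and \<open>t\<close>. Moving one to the even and the other to the odd variables lets a single
    map serve both.\<close>
  obtain \<phi>' where \<phi>': "wf_formula M \<phi>'" "\<And>e. sat M e \<phi>' \<longleftrightarrow> sat M (\<lambda>i. e (2 * i)) \<phi>"
    using rename_formula[OF \<phi>(1)] by metis
  obtain \<psi>' where \<psi>': "wf_formula M \<psi>'" "\<And>e. sat M e \<psi>' \<longleftrightarrow> sat M (\<lambda>i. e (2 * i + 1)) \<psi>"
    using rename_formula[OF \<psi>(1)] by metis
  show ?thesis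
    by (rule definable_predI[of M "FConj \<phi>' \<psi>'" _ "\<lambda>i. if even i then s (i div 2) else t (i div 2)"])
      (simp_all add: \<phi> \<psi> \<phi>' \<psi>')
qed

text \<open>Quantifiers follow the de Bruijn convention: coordinate 0 is the bound value and the
  outer coordinates are shifted up by one.\<close>

lemma definable_pred_ex [definable_intros]:
  assumes "definable_pred M (\<lambda>e. Q (e 0) (\<lambda>i. e (Suc i)))"
  shows "definable_pred M (\<lambda>e. \<exists>v. Q v e)"
proof -
  obtain \<phi> s where \<phi>: "wf_formula M \<phi>"
    "\<And>e. Q (e 0) (\<lambda>i. e (Suc i)) \<longleftrightarrow> sat M (\<lambda>i. val e (s i)) \<phi>"
    using assms by (rule definable_predE) (rule that)
  \<comment> \<open>Several variables may denote coordinate 0; all of them become variable 0, which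
    is then quantified. The others move up by one to avoid capture, and \<open>s'\<close> undoes
    both shifts. Its value at 0 is overwritten by \<open>v\<close>.\<close>
  define \<sigma> where "\<sigma> i = (if s i = Inl 0 then 0 else Suc i)" for i
  define s' where "s' i = (case s (i - 1) of Inl j \<Rightarrow> Inl (j - 1) | Inr c \<Rightarrow> Inr c)" for i
  obtain \<psi> where \<psi>: "wf_formula M \<psi>" "\<And>e. sat M e \<psi> \<longleftrightarrow> sat M (\<lambda>i. e (\<sigma> i)) \<phi>"
    using rename_formula[OF \<phi>(1)] by metis
  have *: "((\<lambda>i. val e (s' i))(0 := v)) (\<sigma> i) = val (case_nat v e) (s i)" for e v i
    by (auto simp: \<sigma>_def s'_def split: sum.split nat.split)
  have "Q v e \<longleftrightarrow> sat M ((\<lambda>i. val e (s' i))(0 := v)) \<psi>" for v e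
    unfolding \<psi>(2) * using \<phi>(2)[of "case_nat v e"] by simp
  then show ?thesis
    by (intro definable_predI[of M "FEx 0 \<psi>" _ s']) (simp_all add: \<psi>(1))
qed

lemma definable_pred_disj [definable_intros]:
  assumes "definable_pred M P" "definable_pred M Q"
  shows "definable_pred M (\<lambda>e. P e \<or> Q e)"
proof -
  have "definable_pred M (\<lambda>e. \<not> (\<not> P e \<and> \<not> Q e))"
    by (intro definable_pred_Not definable_pred_conj assms)
  then show ?thesis
    by simp
qed

lemma definable_pred_imp [definable_intros]:
  assumes "definable_pred M P" "definable_pred M Q"
  shows "definable_pred M (\<lambda>e. P e \<longrightarrow> Q e)"
proof -
  have "definable_pred M (\<lambda>e. \<not> P e \<or> Q e)"
    by (intro definable_pred_Not definable_pred_disj assms)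
  then show ?thesis
    by (simp only: imp_conv_disj)
qed

lemma definable_pred_all [definable_intros]:
  assumes "definable_pred M (\<lambda>e. Q (e 0) (\<lambda>i. e (Suc i)))"
  shows "definable_pred M (\<lambda>e. \<forall>v. Q v e)"
proof -
  have "definable_pred M (\<lambda>e. \<not> (\<exists>v. \<not> Q v e))"
    by (rule definable_pred_Not, rule definable_pred_ex, rule definable_pred_Not, rule assms)
  then show ?thesis
    by simp
qed

lemma definable_pred_eq [definable_intros]:
  assumes "simple_term S" "simple_term T"
  shows "definable_pred M (\<lambda>e. S e = T e)"
proof -
  obtain u v where "S = (\<lambda>e. val e u)" "T = (\<lambda>e. val e v)"
    using assms unfolding simple_term_def by blast
  then show ?thesis
    by (intro definable_predI[of M "FEq (TVar 0) (TVar 1)" _ "\<lambda>i. if i = 0 then u else v"]) simp_all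
qed

lemma definable_pred_const [definable_intros]: "definable_pred M (\<lambda>e. b)"
proof -
  have "definable_pred M (\<lambda>e. e 0 = e 0)"
    by (intro definable_intros)
  then have True: "definable_pred M (\<lambda>e. True)"
    by simp
  show ?thesis
    using True definable_pred_Not[OF True] by (cases b) simp_all
qed

lemma definable_pred_less:
  assumes "expands_real_order M" "simple_term S" "simple_term T"
  shows "definable_pred M (\<lambda>e. S e < T e)"
proof -
  obtain r where r: "rel_arity M r = 2" "\<And>a b. rel_interp M r [a, b] \<longleftrightarrow> a < b"
    using assms(1) unfolding expands_real_order_def by blast
  obtain u v where "S = (\<lambda>e. val e u)" "T = (\<lambda>e. val e v)"
    using assms unfolding simple_term_def by blast
  then show ?thesis
    by (intro definable_predI[of M "FRel r [TVar 0, TVar 1]" _ "\<lambda>i. if i = 0 then u else v"])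
      (simp_all add: r)
qed

lemma definable_pred_mem:
  assumes "definable M n A" "simple_terms T" "\<And>e. length (T e) = n"
  shows "definable_pred M (\<lambda>e. T e \<in> A)"
proof -
  obtain \<phi> p where \<phi>: "wf_formula M \<phi>" "A = {a \<in> tuples n. sat M (assign a p) \<phi>}"
    using assms(1) unfolding definable_def by blast
  obtain us where us: "T = (\<lambda>e. map (val e) us)"
    using assms(2) unfolding simple_terms_def by blast
  then have "length us = n"
    using assms(3)[of undefined] by simp
  note us = this us
  have "(\<lambda>i. val e (if i < n then us ! i else Inr (p (i - n)))) = assign (T e) p" for e
    using us by (auto simp: assign_def)
  moreover have "T e \<in> tuples n" for e
    using us by (simp add: tuples_def)
  ultimately have "T e \<in> A \<longleftrightarrow>
      sat M (\<lambda>i. val e (if i < n then us ! i else Inr (p (i - n)))) \<phi>" for e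
    unfolding \<phi>(2) by simp
  with \<phi>(1) show ?thesis
    by (rule definable_predI)
qed

lemma definable_pred_ex_tuple [definable_intros]:
  fixes M :: "('f, 'r, 'a) fo_structure"
  assumes "definable_pred M (\<lambda>e. Q (map e [0..<m]) (\<lambda>i. e (i + m)))"
  shows "definable_pred M (\<lambda>e. \<exists>x\<in>tuples m. Q x e)"
  using assms
proof (induction m arbitrary: Q)
  case 0
  then show ?case
    by (simp add: tuples_def)
next
  case (Suc m)
  have eq: "(\<exists>x\<in>tuples (Suc m). Q x e) \<longleftrightarrow> (\<exists>x\<in>tuples m. \<exists>t. Q (x @ [t]) e)" for e
    unfolding tuples_def mem_Collect_eq Bex_def length_Suc_conv_rev by blast
  \<comment> \<open>The last entry of the tuple is bound innermost and so sits at coordinate 0,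
    below the first \<open>m\<close> entries; \<open>F\<close> rotates the coordinates back into
    tuple order.\<close>
  define F where "F e i = val e (Inl (if i < m then Suc i else if i = m then 0 else i))"
    for e :: "nat \<Rightarrow> 'a" and i
  have "map (F e) [0..<Suc m] = map (\<lambda>i. e (Suc i)) [0..<m] @ [e 0]" for e
    by (simp add: F_def)
  moreover have "(\<lambda>i. F e (i + Suc m)) = (\<lambda>i. e (Suc (i + m)))" for e
    by (simp add: F_def)
  moreover have "definable_pred M (\<lambda>e. Q (map (F e) [0..<Suc m]) (\<lambda>i. F e (i + Suc m)))"
    unfolding F_def by (rule definable_pred_subst[OF Suc.prems])
  ultimately have "definable_pred M
      (\<lambda>e. Q (map (\<lambda>i. e (Suc i)) [0..<m] @ [e 0]) (\<lambda>i. e (Suc (i + m))))"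
    by (simp only:)
  then have "definable_pred M (\<lambda>e. \<exists>t. Q (map e [0..<m] @ [t]) (\<lambda>i. e (i + m)))"
    by (rule definable_pred_ex)
  then show ?case
    unfolding eq by (rule Suc.IH)
qed

lemma definable_pred_all_tuple [definable_intros]:
  assumes "definable_pred M (\<lambda>e. Q (map e [0..<m]) (\<lambda>i. e (i + m)))"
  shows "definable_pred M (\<lambda>e. \<forall>x\<in>tuples m. Q x e)"
proof -
  have "definable_pred M (\<lambda>e. \<not> (\<exists>x\<in>tuples m. \<not> Q x e))"
    by (rule definable_pred_Not, rule definable_pred_ex_tuple, rule definable_pred_Not, rule assms)
  then show ?thesis
    by simp
qed

lemma definable_subset_tuples: "definable M n A \<Longrightarrow> A \<subseteq> tuples n"
  unfolding definable_def by blast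

lemma definable_pred_bex:
  assumes "definable M m A" "definable_pred M (\<lambda>e. Q (map e [0..<m]) (\<lambda>i. e (i + m)))"
  shows "definable_pred M (\<lambda>e. \<exists>x\<in>A. Q x e)"
proof -
  have "definable_pred M (\<lambda>e. map e [0..<m] \<in> A)"
    by (rule definable_pred_mem[OF assms(1) simple_terms_map]) simp
  then have "definable_pred M (\<lambda>e. \<exists>x\<in>tuples m. x \<in> A \<and> Q x e)"
    by (intro definable_pred_ex_tuple definable_pred_conj assms(2))
  moreover have "(\<exists>x\<in>tuples m. x \<in> A \<and> Q x e) \<longleftrightarrow> (\<exists>x\<in>A. Q x e)" for e
    using definable_subset_tuples[OF assms(1)] by blast
  ultimately show ?thesis
    by simp
qed

lemma definable_pred_ball:
  assumes "definable M m A" "definable_pred M (\<lambda>e. Q (map e [0..<m]) (\<lambda>i. e (i + m)))"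
  shows "definable_pred M (\<lambda>e. \<forall>x\<in>A. Q x e)"
proof -
  have "definable_pred M (\<lambda>e. \<not> (\<exists>x\<in>A. \<not> Q x e))"
    by (rule definable_pred_Not, rule definable_pred_bex[OF assms(1)], rule definable_pred_Not, rule assms(2))
  then show ?thesis
    by simp
qed

lemma definable_Collect:
  assumes "definable_pred M (\<lambda>e. R (map e [0..<n]))"
  shows "definable M n {x \<in> tuples n. R x}"
proof -
  obtain \<phi> s where \<phi>: "wf_formula M \<phi>" "\<And>e. R (map e [0..<n]) \<longleftrightarrow> sat M (\<lambda>i. val e (s i)) \<phi>"
    using assms by (rule definable_predE) (rule that)
  \<comment> \<open>Back to the format of \<open>assign\<close>: variables denoting a coordinate
    below \<open>n\<close> are kept as such, and every other variable \<open>i\<close> becomes the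
    parameter variable \<open>n + i\<close>. Coordinates from \<open>n\<close> on have no influence
    on \<open>R\<close> and are filled from the arbitrary function \<open>undefined\<close>.\<close>
  define \<sigma> where "\<sigma> i = (case s i of Inl j \<Rightarrow> if j < n then j else n + i | Inr c \<Rightarrow> n + i)" for i
  define p where "p i = (case s i of Inl j \<Rightarrow> undefined (j - n) | Inr c \<Rightarrow> c)" for i
  obtain \<psi> where \<psi>: "wf_formula M \<psi>" "\<And>e. sat M e \<psi> \<longleftrightarrow> sat M (\<lambda>i. e (\<sigma> i)) \<phi>"
    using rename_formula[OF \<phi>(1)] by metis
  have "R x \<longleftrightarrow> sat M (assign x p) \<psi>" if "x \<in> tuples n" for x
  proof -
    have len: "length x = n"
      using that by (simp add: tuples_def)
    then have "map (assign x undefined) [0..<n] = x"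
      by (auto simp: assign_def intro: nth_equalityI)
    moreover have "val (assign x undefined) (s i) = assign x p (\<sigma> i)" for i
      using len by (auto simp: assign_def \<sigma>_def p_def split: sum.split)
    ultimately show ?thesis
      using \<phi>(2)[of "assign x undefined"] by (simp add: \<psi>(2))
  qed
  then have "{x \<in> tuples n. R x} = {x \<in> tuples n. sat M (assign x p) \<psi>}"
    by blast
  then show ?thesis
    unfolding definable_def using \<psi>(1) by blast
qed

lemma definable_Collect_snoc:
  assumes "definable_pred M (\<lambda>e. R (map e [0..<n]) (e n))"
  shows "definable M (Suc n) {x @ [t] |x t. x \<in> tuples n \<and> R x t}"
proof -
  have "definable_pred M (\<lambda>e. (\<lambda>y. R (take n y) (y ! n)) (map e [0..<Suc n]))"
    using assms by (simp add: nth_append)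
  then have "definable M (Suc n) {y \<in> tuples (Suc n). R (take n y) (y ! n)}"
    by (rule definable_Collect)
  also have "{y \<in> tuples (Suc n). R (take n y) (y ! n)} = {x @ [t] |x t. x \<in> tuples n \<and> R x t}"
    by (auto simp: tuples_def length_Suc_conv_rev nth_append)
  finally show ?thesis .
qed

section \<open>Consequences of o-minimality\<close>

lemma einterval_countable:
  assumes "countable (einterval a b)"
  shows "einterval a b = {}"
proof (rule ccontr)
  assume "einterval a b \<noteq> {}"
  then obtain x y where "a < ereal x" "ereal x < ereal y" "ereal y < b"
    by (metis einterval_iff ereal_dense2 equals0I)
  then have "{x<..<y} \<subseteq> einterval a b"
    by (auto simp: einterval_iff) (meson ereal_less(3) less_ereal.simps(1) less_trans)+
  then show False
    using assms uncountable_open_interval[of x y] \<open>ereal x < ereal y\<close> countable_subset by auto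
qed

locale o_minimal =
  fixes M :: "('f, 'r, real) fo_structure"
  assumes o_minimal: "o_minimal_expansion M"
begin

lemma expands: "expands_real_order M"
  using o_minimal unfolding o_minimal_expansion_def by blast

lemmas [definable_intros] = definable_pred_less[OF expands]

text \<open>An open interval that is countable is empty, so only the points among the finitely many
  pieces remain.\<close>

lemma definable_countable_finite:
  assumes "definable M 1 ((\<lambda>t. [t]) ` A)" "countable A"
  shows "finite A"
proof -
  obtain \<C> where \<C>: "finite \<C>" "A = \<Union>\<C>"
    and C: "\<And>C. C \<in> \<C> \<Longrightarrow> (\<exists>t. C = {t}) \<or> (\<exists>a b. C = einterval a b)"
    using o_minimal assms(1) unfolding o_minimal_expansion_def by metis
  have "finite C" if "C \<in> \<C>" for C
  proof -
    have "countable C"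
      using that assms(2) \<C>(2) countable_subset by (metis Union_upper)
    then show ?thesis
      using C[OF that] einterval_countable by (metis finite.simps)
  qed
  then show ?thesis
    using \<C> by blast
qed

text \<open>One of the finitely many pieces is uncountable, hence a nonempty interval. Rational
  endpoints leave only countably many candidates, which allows pigeonhole arguments over
  them.\<close>

lemma definable_uncountable_interval:
  assumes "definable M 1 ((\<lambda>t. [t]) ` A)" "uncountable A"
  obtains p q where "p \<in> \<rat>" "q \<in> \<rat>" "p < q" "{p<..<q} \<subseteq> A"
proof -
  obtain \<C> where \<C>: "finite \<C>" "A = \<Union>\<C>"
    and C: "\<And>C. C \<in> \<C> \<Longrightarrow> (\<exists>t. C = {t}) \<or> (\<exists>a b. C = einterval a b)"
    using o_minimal assms(1) unfolding o_minimal_expansion_def by metis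
  obtain C where "C \<in> \<C>" "uncountable C"
    using assms(2) countable_UN[OF countable_finite[OF \<C>(1)], of "\<lambda>C. C"] unfolding \<C>(2) by auto
  then obtain a b where ab: "C = einterval a b" "einterval a b \<noteq> {}"
    using C by (metis countable_empty countable_insert)
  then obtain x where "a < ereal x" "ereal x < b"
    using einterval_iff by blast
  moreover from this obtain y where "ereal x < ereal y" "ereal y < b"
    using ereal_dense2 by blast
  ultimately have xy: "a < ereal x" "x < y" "ereal y < b"
    by auto
  obtain p where p: "p \<in> \<rat>" "x < p" "p < y"
    using Rats_dense_in_real[OF xy(2)] by blast
  obtain q where q: "q \<in> \<rat>" "p < q" "q < y"
    using Rats_dense_in_real[OF p(3)] by blast
  have "{p<..<q} \<subseteq> C"
  proof
    fix t assume t: "t \<in> {p<..<q}"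
    then have "ereal x < ereal t" "ereal t < ereal y"
      using p q by auto
    then show "t \<in> C"
      using xy less_trans unfolding ab(1) einterval_iff by blast
  qed
  then show ?thesis
    using that[OF p(1) q(1,2)] \<open>C \<in> \<C>\<close> \<C>(2) by blast
qed

lemma definable_line:
  assumes "definable_pred M (\<lambda>e. P (e 0))"
  shows "definable M 1 ((\<lambda>t. [t]) ` {t. P t})"
proof -
  have "definable M 1 {x \<in> tuples 1. P (x ! 0)}"
    using assms by (intro definable_Collect) simp
  moreover have "{x \<in> tuples 1. P (x ! 0)} = (\<lambda>t. [t]) ` {t. P t}"
    by (auto simp: tuples_def length_Suc_conv)
  ultimately show ?thesis
    by simp
qed

lemma uncountable_iff_interval:
  assumes "definable_pred M (\<lambda>e. P (e 0))"
  shows "uncountable {t. P t} \<longleftrightarrow> (\<exists>p q. p < q \<and> (\<forall>t. p < t \<longrightarrow> t < q \<longrightarrow> P t))"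
proof
  assume "uncountable {t. P t}"
  then obtain p q where "p < q" "{p<..<q} \<subseteq> {t. P t}"
    using definable_uncountable_interval[OF definable_line[OF assms]] by metis
  then show "\<exists>p q. p < q \<and> (\<forall>t. p < t \<longrightarrow> t < q \<longrightarrow> P t)"
    by (metis CollectD greaterThanLessThan_iff in_mono)
next
  assume "\<exists>p q. p < q \<and> (\<forall>t. p < t \<longrightarrow> t < q \<longrightarrow> P t)"
  then obtain p q where "p < q" "\<forall>t. p < t \<longrightarrow> t < q \<longrightarrow> P t"
    by blast
  then have "p < q" "{p<..<q} \<subseteq> {t. P t}"
    by auto
  then show "uncountable {t. P t}"
    using uncountable_open_interval countable_subset by metis
qed

section \<open>Definability of dimension in families\<close>

lemma definable_pred_uncountable [definable_intros]:
  assumes "definable_pred M (\<lambda>e. Q (e 0) (\<lambda>i. e (Suc i)))"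
  shows "definable_pred M (\<lambda>e. uncountable {t. Q t e})"
proof -
  \<comment> \<open>Freezing the outer coordinates as parameters leaves a definable subset of the
    line. There uncountability amounts to containing an interval, a first-order condition uniform in
    the parameters.\<close>
  have "definable_pred M (\<lambda>e. Q (e 0) e')" for e'
    using definable_pred_subst[OF assms, of "case_nat (Inl 0) (\<lambda>i. Inr (e' i))"] by simp
  then have "uncountable {t. Q t e} \<longleftrightarrow> (\<exists>p q. p < q \<and> (\<forall>t. p < t \<longrightarrow> t < q \<longrightarrow> Q t e))" for e
    by (rule uncountable_iff_interval)
  moreover have "definable_pred M (\<lambda>e. Q (e 0) (\<lambda>i. e (Suc (Suc (Suc i)))))"
    using definable_pred_subst[OF assms, of "case_nat (Inl 0) (\<lambda>i. Inl (Suc (Suc (Suc i))))"] by simp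
  ultimately show ?thesis
    by (simp only:) (intro definable_intros)
qed

lemma definable_pred_dim_ge:
  assumes "definable_pred M (\<lambda>e. R (map e [0..<m]) (\<lambda>i. e (i + m)))"
  shows "definable_pred M (\<lambda>e. dim_ge m k {x \<in> tuples m. R x e})"
  using assms
proof (induction m arbitrary: R k)
  case 0
  then show ?case
    by (cases "k = 0") (simp_all add: tuples_def definable_pred_const)
next
  case (Suc m)
  \<comment> \<open>When the tail of the tuple is bound first it occupies the coordinates below
    \<open>m\<close>, and the head sits at coordinate \<open>m\<close>; \<open>g\<close> rotates
    them into the order that \<open>R\<close> expects.\<close>
  define g where "g i = (if i = 0 then m else if i \<le> m then i - 1 else i)" for i
  have "(\<lambda>e. R (map (\<lambda>i. val e (Inl (g i))) [0..<Suc m]) (\<lambda>i. val e (Inl (g (i + Suc m)))))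
      = (\<lambda>e. R (e m # map e [0..<m]) (\<lambda>i. e (Suc (i + m))))"
  proof -
    have "map (\<lambda>i. val e (Inl (g i))) [0..<Suc m] = e m # map e [0..<m]"
      for e :: "nat \<Rightarrow> real"
      by (rule nth_equalityI) (auto simp: g_def nth_Cons simp del: upt_Suc split: nat.split)
    moreover have "(\<lambda>i. val e (Inl (g (i + Suc m)))) = (\<lambda>i. e (Suc (i + m)))" for e :: "nat \<Rightarrow> real"
      by (simp add: g_def)
    ultimately show ?thesis
      by (simp only:)
  qed
  moreover have "definable_pred M
      (\<lambda>e. R (map (\<lambda>i. val e (Inl (g i))) [0..<Suc m]) (\<lambda>i. val e (Inl (g (i + Suc m)))))"
    by (rule definable_pred_subst[OF Suc.prems])
  ultimately have "definable_pred M (\<lambda>e. R (e (0 + m) # map e [0..<m]) (\<lambda>i. e (Suc i + m)))"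
    by simp
  then have slice: "definable_pred M (\<lambda>e. dim_ge m j {x \<in> tuples m. R (e 0 # x) (\<lambda>i. e (Suc i))})" for j
    by (rule Suc.IH[where R = "\<lambda>x e. R (e 0 # x) (\<lambda>i. e (Suc i))"])
  have tuple: "{xs. t # xs \<in> {x \<in> tuples (Suc m). R x e}} = {x \<in> tuples m. R (t # x) e}" for t e
    by (auto simp: tuples_def)
  have ex: "definable_pred M (\<lambda>e. \<exists>t. dim_ge m k {x \<in> tuples m. R (t # x) e})"
    by (rule definable_pred_ex, rule slice)
  have un: "definable_pred M (\<lambda>e. uncountable {t. dim_ge m j {x \<in> tuples m. R (t # x) e}})" for j
    by (rule definable_pred_uncountable, rule slice)
  show ?case
  proof (cases k)
    case 0
    then show ?thesis
      unfolding dim_ge.simps tuple using ex by simp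
  next
    case (Suc j)
    then show ?thesis
      unfolding dim_ge.simps tuple using definable_pred_disj[OF ex un] by simp
  qed
qed

lemma dim_ge_Suc_definable:
  assumes "definable M (Suc m) A"
  shows "definable_pred M (\<lambda>e. dim_ge m k {x. e 0 # x \<in> A})"
proof -
  have "definable_pred M (\<lambda>e. dim_ge m k {x \<in> tuples m. e 0 # x \<in> A})"
    by (intro definable_pred_dim_ge definable_pred_mem[OF assms] definable_intros) simp
  moreover have "{x \<in> tuples m. t # x \<in> A} = {x. t # x \<in> A}" for t
    using definable_subset_tuples[OF assms] by (auto simp: tuples_def)
  ultimately show ?thesis
    by simp
qed

lemma definable_slice:
  assumes "definable M (Suc m) A"
  shows "definable M m {x. t # x \<in> A}"
proof -
  have "definable M m {x \<in> tuples m. t # x \<in> A}"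
    by (intro definable_Collect definable_pred_mem[OF assms] definable_intros) simp
  moreover have "{x \<in> tuples m. t # x \<in> A} = {x. t # x \<in> A}" for t
    using definable_subset_tuples[OF assms] by (auto simp: tuples_def)
  ultimately show ?thesis
    by simp
qed

text \<open>Induction on \<open>m\<close>. Only finitely many fibres of \<open>B\<close> have
  dimension \<open>k\<close>, since uncountably many would give \<open>B\<close> dimension
  \<open>k + 1\<close>; take a transversal in each of them. If \<open>A\<close> has dimension
  \<open>k\<close> but none of its fibres has, then a whole interval of fibres has dimension
  \<open>k - 1\<close>, and this interval contains a rational \<open>t\<close> outside the finite
  set. So transversals for dimension \<open>k - 1\<close> in the fibres over rationals complete the
  set.\<close>

lemma countable_transversal:
  assumes "definable M m B" "\<not> dim_ge m (Suc k) B"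
  shows "\<exists>D. countable D \<and> D \<subseteq> B \<and> (\<forall>A. definable M m A \<longrightarrow> A \<subseteq> B \<longrightarrow> dim_ge m k A \<longrightarrow> A \<inter> D \<noteq> {})"
  using assms
proof (induction m arbitrary: k B)
  case 0
  then show ?case
    by (intro exI[of _ "B \<inter> {[]}"]) auto
next
  case (Suc m)
  let ?s = "\<lambda>A t. {x. t # x \<in> A}"
  define F where "F = {t. dim_ge m k (?s B t)}"
  have "countable F"
    using Suc.prems(2) unfolding F_def by auto
  then have finF: "finite F"
    unfolding F_def
    by (intro definable_countable_finite definable_line dim_ge_Suc_definable[OF Suc.prems(1)])
  have small: "\<not> dim_ge m (Suc k) (?s B t)" for t
    using Suc.prems(2) by auto
  have "\<exists>D. countable D \<and> D \<subseteq> ?s B t \<and>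
      (\<forall>A. definable M m A \<longrightarrow> A \<subseteq> ?s B t \<longrightarrow> dim_ge m k A \<longrightarrow> A \<inter> D \<noteq> {})" for t
    by (intro Suc.IH definable_slice Suc.prems(1) small)
  then obtain D where D: "\<And>t. countable (D t)" "\<And>t. D t \<subseteq> ?s B t"
    "\<And>t A. definable M m A \<Longrightarrow> A \<subseteq> ?s B t \<Longrightarrow> dim_ge m k A \<Longrightarrow> A \<inter> D t \<noteq> {}"
    by metis
  \<comment> \<open>The conditions on \<open>k\<close> and \<open>t\<close> stand inside the
    statement so that one choice function \<open>D'\<close> exists for all \<open>t\<close>, with
    \<open>{}\<close> as a placeholder where they fail.\<close>
  have "\<exists>D. countable D \<and> D \<subseteq> ?s B t \<and> (\<forall>j A. k = Suc j \<longrightarrow> t \<notin> F \<longrightarrow>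
      definable M m A \<longrightarrow> A \<subseteq> ?s B t \<longrightarrow> dim_ge m j A \<longrightarrow> A \<inter> D \<noteq> {})" for t
  proof (cases "\<exists>j. k = Suc j \<and> t \<notin> F")
    case True
    then obtain j where j: "k = Suc j" "t \<notin> F"
      by blast
    then have "\<exists>D. countable D \<and> D \<subseteq> ?s B t \<and>
        (\<forall>A. definable M m A \<longrightarrow> A \<subseteq> ?s B t \<longrightarrow> dim_ge m j A \<longrightarrow> A \<inter> D \<noteq> {})"
      by (intro Suc.IH definable_slice Suc.prems(1)) (simp add: F_def)
    then show ?thesis
      using j by simp
  next
    case False
    then show ?thesis
      by (intro exI[of _ "{}"]) auto
  qed
  then obtain D' where D': "\<And>t. countable (D' t)" "\<And>t. D' t \<subseteq> ?s B t"
    "\<And>t j A. k = Suc j \<Longrightarrow> t \<notin> F \<Longrightarrow> definable M m A \<Longrightarrow> A \<subseteq> ?s B t \<Longrightarrow> dim_ge m j A \<Longrightarrow>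
      A \<inter> D' t \<noteq> {}"
    by metis
  define E where "E = (\<Union>t\<in>F. (#) t ` D t) \<union> (\<Union>t\<in>\<rat>. (#) t ` D' t)"
  show ?case
  proof (intro exI[of _ E] conjI allI impI)
    show "countable E"
      unfolding E_def using finF D(1) D'(1) countable_rat
      by (intro countable_Un countable_UN countable_image) (auto intro: countable_finite)
    show "E \<subseteq> B"
      unfolding E_def using D(2) D'(2) by blast
    fix A assume A: "definable M (Suc m) A" "A \<subseteq> B" "dim_ge (Suc m) k A"
    have sub: "?s A t \<subseteq> ?s B t" for t
      using A(2) by blast
    show "A \<inter> E \<noteq> {}"
    proof (cases "\<exists>t. dim_ge m k (?s A t)")
      case True
      then obtain t where t: "dim_ge m k (?s A t)"
        by blast
      then have "t \<in> F"
        using sub dim_ge_mono unfolding F_def by blast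
      moreover have "?s A t \<inter> D t \<noteq> {}"
        by (intro D(3) definable_slice A(1) sub t)
      ultimately show ?thesis
        unfolding E_def by blast
    next
      case False
      then obtain j where j: "k = Suc j" "uncountable {t. dim_ge m j (?s A t)}"
        using A(3) by auto
      obtain p q where pq: "p < q" "{p<..<q} \<subseteq> {t. dim_ge m j (?s A t)}"
        using definable_uncountable_interval[OF definable_line[OF dim_ge_Suc_definable[OF A(1)]] j(2)]
        by metis
      \<comment> \<open>Removing the finite set \<open>F\<close> from the interval leaves a nonempty
        open set, which contains a rational.\<close>
      have "infinite {p<..<q}"
        using pq(1) infinite_Ioo by blast
      then obtain x where "x \<in> {p<..<q} - F"
        using finF by (metis Diff_infinite_finite ex_in_conv finite.emptyI)
      moreover have "open ({p<..<q} - F)"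
        using finF by (intro open_Diff finite_imp_closed) auto
      ultimately obtain \<epsilon> where e: "\<epsilon> > 0" "ball x \<epsilon> \<subseteq> {p<..<q} - F"
        using open_contains_ball by metis
      obtain t where "t \<in> \<rat>" "x < t" "t < x + \<epsilon>"
        using Rats_dense_in_real[of x "x + \<epsilon>"] e(1) by auto
      then have t: "t \<in> {p<..<q}" "t \<in> \<rat>" "t \<notin> F"
        using subsetD[OF e(2), of t] by (auto simp: dist_real_def)
      then have "?s A t \<inter> D' t \<noteq> {}"
        using pq(2) by (intro D'(3)[OF j(1)] definable_slice A(1) sub) auto
      then obtain x where "t # x \<in> A" "x \<in> D' t"
        by auto
      moreover from this have "t # x \<in> E"
        unfolding E_def using t(2) by (intro UnI2 UN_I[of t] image_eqI[of _ _ x]) auto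
      ultimately show ?thesis
        by blast
    qed
  qed
qed

end

section \<open>Cells\<close>

lemma cell_subset_tuples: "cell M ks C \<Longrightarrow> C \<subseteq> tuples (length ks)"
  by (induction rule: cell.induct) (auto simp: tuples_def)

text \<open>Additivity over fibres along the construction of the cell: a graph has one-point fibres,
  a band has nonempty open intervals as fibres.\<close>

lemma cell_dim:
  assumes "cell M ks C"
  shows "dim_ge (length ks) (sum_list ks) C" "\<not> dim_ge (length ks) (Suc (sum_list ks)) C"
  using assms
proof (induction rule: cell.induct)
  case point
  {
    case 1
    show ?case by simp
  next
    case 2
    show ?case by simp
  }
next
  case (graph ks C f)
  let ?W = "{x @ [f x] |x. x \<in> C}"
  {
    case 1
    have "dim_ge (length ks + Suc 0) (sum_list ks + 0) ?W"
      by (rule dim_ge_superadditive[OF graph.IH(1)]) (simp add: dim_ge_1)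
    then show ?case by simp
  next
    case 2
    have "\<not> dim_ge (length ks + Suc 0) (Suc (sum_list ks) + 0) ?W"
    proof
      assume "dim_ge (length ks + Suc 0) (Suc (sum_list ks) + 0) ?W"
      then have "dim_ge (length ks) (Suc (sum_list ks)) C"
      proof (rule dim_ge_subadditive)
        fix z w :: "real list" assume "length w = Suc 0" "z @ w \<in> ?W"
        then show "z \<in> C"
          by (auto simp: length_Suc_conv)
      next
        fix z
        have "{t. [t] \<in> {w. z @ w \<in> ?W}} \<subseteq> {f z}"
          by auto
        then have "countable {t. [t] \<in> {w. z @ w \<in> ?W}}"
          by (rule countable_subset) simp
        then show "\<not> dim_ge (Suc 0) (Suc 0) {w. z @ w \<in> ?W}"
          unfolding dim_ge_1 by simp
      qed
      then show False
        using graph.IH(2) by simp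
    qed
    then show ?case by simp
  }
next
  case (band ks C f g)
  let ?W = "{x @ [t] |x t. x \<in> C \<and> f x < ereal t \<and> ereal t < g x}"
  {
    case 1
    have "dim_ge (length ks + Suc 0) (sum_list ks + Suc 0) ?W"
    proof (rule dim_ge_superadditive[OF band.IH(1)])
      fix z assume "z \<in> C"
      then have eq: "{t. [t] \<in> {w. z @ w \<in> ?W}} = einterval (f z) (g z)"
        unfolding einterval_def by simp
      have "f z < g z"
        using \<open>z \<in> C\<close> band.hyps(4) by blast
      then have "einterval (f z) (g z) \<noteq> {}"
        using ereal_dense2 einterval_iff by blast
      then have "uncountable {t. [t] \<in> {w. z @ w \<in> ?W}}"
        unfolding eq using einterval_countable by blast
      then show "dim_ge (Suc 0) (Suc 0) {w. z @ w \<in> ?W}"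
        unfolding dim_ge_1 by simp
    qed
    then show ?case by simp
  next
    case 2
    have "\<not> dim_ge (length ks + Suc 0) (Suc (sum_list ks) + Suc 0) ?W"
    proof
      assume "dim_ge (length ks + Suc 0) (Suc (sum_list ks) + Suc 0) ?W"
      then have "dim_ge (length ks) (Suc (sum_list ks)) C"
      proof (rule dim_ge_subadditive)
        fix z w :: "real list" assume "length w = Suc 0" "z @ w \<in> ?W"
        then show "z \<in> C"
          by (auto simp: length_Suc_conv)
      next
        fix z show "\<not> dim_ge (Suc 0) (Suc (Suc 0)) {w. z @ w \<in> ?W}"
          unfolding dim_ge_1 by simp
      qed
      then show False
        using band.IH(2) by simp
    qed
    then show ?case by simp
  }
qed

section \<open>Open boxes\<close>

text \<open>A box is given by two opposite corners, so that a first-order formula can quantify over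
  boxes. It is empty when the corners have different lengths.\<close>

definition box_between :: "real list \<Rightarrow> real list \<Rightarrow> real list set" where
  "box_between p q = {x. list_all2 (<) p x \<and> list_all2 (<) x q}"

lemma box_between_snoc:
  "x @ [t] \<in> box_between (p @ [a]) (q @ [b]) \<longleftrightarrow> x \<in> box_between p q \<and> a < t \<and> t < b"
proof -
  have "list_all2 (<) (p @ [a]) (x @ [t]) \<longleftrightarrow> list_all2 (<) p x \<and> a < t" for p x :: "real list" and a t
    by (cases "length p = length x") (auto simp: list_all2_append dest: list_all2_lengthD)
  then show ?thesis
    unfolding box_between_def by auto
qed

lemma box_between_length: "x \<in> box_between p q \<Longrightarrow> length p = length x \<and> length q = length x"
  unfolding box_between_def by (auto dest: list_all2_lengthD)

lemma openin_box_between: "openin (tuple_topology (length p)) (box_between p q)"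
proof (cases "length q = length p")
  case True
  let ?n = "length p"
  let ?U = "\<Pi>\<^sub>E i\<in>{..<?n}. {p ! i<..<q ! i}"
  have "openin (powertop_real {..<?n}) ?U"
    by (subst openin_PiE) auto
  moreover have "box_between p q = (\<lambda>xs. restrict (nth xs) {..<?n}) -` ?U \<inter> tuples ?n"
  proof (rule set_eqI)
    fix x
    have "x \<in> box_between p q \<longleftrightarrow> length x = ?n \<and> (\<forall>i<?n. p ! i < x ! i \<and> x ! i < q ! i)"
      unfolding box_between_def list_all2_conv_all_nth mem_Collect_eq using True by metis
    moreover have "restrict (nth x) {..<?n} \<in> ?U \<longleftrightarrow> (\<forall>i<?n. p ! i < x ! i \<and> x ! i < q ! i)"
      by (simp add: PiE_iff Ball_def)
    ultimately show "x \<in> box_between p q \<longleftrightarrow>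
        x \<in> (\<lambda>xs. restrict (nth xs) {..<?n}) -` ?U \<inter> tuples ?n"
      unfolding tuples_def by blast
  qed
  ultimately show ?thesis
    unfolding tuple_topology_def openin_pullback_topology by blast
next
  case False
  then have "box_between p q = {}"
    using box_between_length by fastforce
  then show ?thesis
    by simp
qed

lemma definable_pred_list_all2:
  assumes "\<And>S T :: (nat \<Rightarrow> 'a) \<Rightarrow> 'a. simple_term S \<Longrightarrow> simple_term T \<Longrightarrow> definable_pred M (\<lambda>e. P (S e) (T e))"
    and "simple_terms S" "simple_terms T"
  shows "definable_pred M (\<lambda>e. list_all2 P (S e) (T e))"
proof -
  have *: "definable_pred M (\<lambda>e. list_all2 P (map (val e) us) (map (val e) vs))" for us vs :: "(nat + 'a) list"
  proof (induction us arbitrary: vs)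
    case Nil
    then show ?case
      by (simp add: definable_pred_const)
  next
    case (Cons u us)
    show ?case
    proof (cases vs)
      case Nil
      then show ?thesis
        by (simp add: definable_pred_const)
    next
      case (Cons v vs')
      have "definable_pred M (\<lambda>e. P (val e u) (val e v))"
        by (intro assms(1)) (auto simp: simple_term_def)
      then show ?thesis
        unfolding Cons list.map list.rel_inject
        by (rule definable_pred_conj[OF _ Cons.IH])
    qed
  qed
  obtain us vs where "S = (\<lambda>e. map (val e) us)" "T = (\<lambda>e. map (val e) vs)"
    using assms(2,3) unfolding simple_terms_def by blast
  then show ?thesis
    using * by simp
qed

lemma definable_Int:
  assumes "definable M n A" "definable M n B"
  shows "definable M n (A \<inter> B)"
proof -
  have "definable M n {x \<in> tuples n. x \<in> A \<and> x \<in> B}"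
    by (intro definable_Collect definable_pred_conj definable_pred_mem[OF assms(1)]
        definable_pred_mem[OF assms(2)] definable_intros) simp_all
  moreover have "{x \<in> tuples n. x \<in> A \<and> x \<in> B} = A \<inter> B"
    using definable_subset_tuples[OF assms(1)] by blast
  ultimately show ?thesis
    by simp
qed

context o_minimal
begin

section \<open>Definability of boxes and cells, and large subsets of cells\<close>

lemma definable_pred_box_between [definable_intros]:
  assumes "simple_terms S" "simple_terms T" "simple_terms U"
  shows "definable_pred M (\<lambda>e. T e \<in> box_between (S e) (U e))"
  unfolding box_between_def mem_Collect_eq
  by (intro definable_pred_conj definable_pred_list_all2 definable_intros assms)

lemma cell_bound_definable:
  assumes C: "definable M n C" and f: "cell_bound M n C f"
  shows "definable M (Suc n) {x @ [t] |x t. x \<in> C \<and> f x < ereal t}"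
    and "definable M (Suc n) {x @ [t] |x t. x \<in> C \<and> ereal t < f x}"
proof -
  note C_tup = definable_subset_tuples[OF C]
  note memC = definable_pred_mem[OF C]
  have aux: "definable M (Suc n) {x @ [t] |x t. x \<in> C \<and> Q x t}"
    if "definable_pred M (\<lambda>e. Q' (map e [0..<n]) (e n))" "\<And>x t. x \<in> C \<Longrightarrow> Q' x t \<longleftrightarrow> Q x t" for Q Q'
  proof -
    have "definable M (Suc n) {x @ [t] |x t. x \<in> tuples n \<and> (x \<in> C \<and> Q' x t)}"
      by (rule definable_Collect_snoc, intro definable_pred_conj memC that(1) definable_intros) simp
    also have "{x @ [t] |x t. x \<in> tuples n \<and> (x \<in> C \<and> Q' x t)} = {x @ [t] |x t. x \<in> C \<and> Q x t}"
      using C_tup that(2) by blast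
    finally show ?thesis .
  qed
  from f consider f' where "definable_continuous M n C f'" "\<forall>x\<in>C. f x = ereal (f' x)"
    | "\<forall>x\<in>C. f x = -\<infinity>" | "\<forall>x\<in>C. f x = \<infinity>"
    unfolding cell_bound_def by blast
  then have "definable M (Suc n) {x @ [t] |x t. x \<in> C \<and> f x < ereal t} \<and>
    definable M (Suc n) {x @ [t] |x t. x \<in> C \<and> ereal t < f x}"
  proof cases
    case 1
    define \<Gamma> where "\<Gamma> = {x @ [f' x] |x. x \<in> C}"
    have \<Gamma>: "definable M (Suc n) \<Gamma>"
      using 1(1) unfolding definable_continuous_def \<Gamma>_def by blast
    have "definable M (Suc n) {x @ [t] |x t. x \<in> C \<and> f x < ereal t}"
    proof (rule aux)
      show "definable_pred M (\<lambda>e. \<exists>s. map e [0..<n] @ [s] \<in> \<Gamma> \<and> s < e n)"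
        by (intro definable_pred_mem[OF \<Gamma>] definable_intros) simp
    qed (use 1(2) in \<open>auto simp: \<Gamma>_def\<close>)
    moreover have "definable M (Suc n) {x @ [t] |x t. x \<in> C \<and> ereal t < f x}"
    proof (rule aux)
      show "definable_pred M (\<lambda>e. \<exists>s. map e [0..<n] @ [s] \<in> \<Gamma> \<and> e n < s)"
        by (intro definable_pred_mem[OF \<Gamma>] definable_intros) simp
    qed (use 1(2) in \<open>auto simp: \<Gamma>_def\<close>)
    ultimately show ?thesis ..
  next
    case 2
    have "definable M (Suc n) {x @ [t] |x t. x \<in> C \<and> f x < ereal t}"
      by (rule aux[of "\<lambda>x t. True"]) (use 2 definable_pred_const in auto)
    moreover have "definable M (Suc n) {x @ [t] |x t. x \<in> C \<and> ereal t < f x}"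
      by (rule aux[of "\<lambda>x t. False"]) (use 2 definable_pred_const in auto)
    ultimately show ?thesis ..
  next
    case 3
    have "definable M (Suc n) {x @ [t] |x t. x \<in> C \<and> f x < ereal t}"
      by (rule aux[of "\<lambda>x t. False"]) (use 3 definable_pred_const in auto)
    moreover have "definable M (Suc n) {x @ [t] |x t. x \<in> C \<and> ereal t < f x}"
      by (rule aux[of "\<lambda>x t. True"]) (use 3 definable_pred_const in auto)
    ultimately show ?thesis ..
  qed
  then show "definable M (Suc n) {x @ [t] |x t. x \<in> C \<and> f x < ereal t}"
    "definable M (Suc n) {x @ [t] |x t. x \<in> C \<and> ereal t < f x}"
    by blast+
qed

lemma cell_definable: "cell M ks C \<Longrightarrow> definable M (length ks) C"
proof (induction rule: cell.induct)
  case point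
  have "definable M 0 {x \<in> tuples 0. True}"
    by (intro definable_Collect definable_pred_const)
  then show ?case
    by (simp add: tuples_def)
next
  case (graph ks C f)
  then show ?case
    unfolding definable_continuous_def by simp
next
  case (band ks C f g)
  have "{x @ [t] |x t. x \<in> C \<and> f x < ereal t \<and> ereal t < g x} =
    {x @ [t] |x t. x \<in> C \<and> f x < ereal t} \<inter> {x @ [t] |x t. x \<in> C \<and> ereal t < g x}"
    by auto
  then show ?case
    using definable_Int cell_bound_definable(1)[OF band.IH band.hyps(2)]
      cell_bound_definable(2)[OF band.IH band.hyps(3)] by simp
qed

text \<open>Every uncountable fibre contains one of countably many rational intervals, so a single
  interval works over a set of base points that still has dimension \<open>k\<close>.\<close>

lemma dim_ge_uncountable_fibres:
  assumes E: "definable M (Suc m) E" and "dim_ge m k {x. uncountable {t. x @ [t] \<in> E}}"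
  obtains a b where "a < b" "dim_ge m k {x \<in> tuples m. \<forall>t. a < t \<longrightarrow> t < b \<longrightarrow> x @ [t] \<in> E}"
proof -
  define I where "I = {(a, b). a \<in> \<rat> \<and> b \<in> \<rat> \<and> a < (b::real)}"
  define F where "F ab = {x \<in> tuples m. \<forall>t. fst ab < t \<longrightarrow> t < snd ab \<longrightarrow> x @ [t] \<in> E}" for ab
  have "I \<subseteq> \<rat> \<times> \<rat>"
    by (auto simp: I_def)
  then have "countable I"
    using countable_rat countable_SIGMA countable_subset by metis
  have "{x. uncountable {t. x @ [t] \<in> E}} \<subseteq> (\<Union>ab\<in>I. F ab)"
  proof
    fix x assume "x \<in> {x. uncountable {t. x @ [t] \<in> E}}"
    then have unc: "uncountable {t. x @ [t] \<in> E}"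
      by simp
    then obtain s where "x @ [s] \<in> E"
      by (metis (no_types, lifting) Collect_empty_eq countable_empty)
    then have x: "x \<in> tuples m"
      using definable_subset_tuples[OF E] by (auto simp: tuples_def)
    have "definable_pred M (\<lambda>e. x @ [e 0] \<in> E)"
      using x by (intro definable_pred_mem[OF E] definable_intros) (simp add: tuples_def)
    then obtain p q where "p \<in> \<rat>" "q \<in> \<rat>" "p < q" "{p<..<q} \<subseteq> {t. x @ [t] \<in> E}"
      using definable_uncountable_interval[OF definable_line unc] by metis
    then have "(p, q) \<in> I" "x \<in> F (p, q)"
      using x by (auto simp: I_def F_def subset_iff)
    then show "x \<in> (\<Union>ab\<in>I. F ab)"
      by blast
  qed
  then have "dim_ge m k (\<Union>ab\<in>I. F ab)"
    by (rule dim_ge_mono[OF assms(2)])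
  then obtain ab where "ab \<in> I" "dim_ge m k (F ab)"
    using dim_ge_UN[OF \<open>countable I\<close>] by blast
  then show ?thesis
    using that[of "fst ab" "snd ab"] unfolding I_def F_def by auto
qed

lemma definable_fibres_contain_interval:
  assumes "definable M (Suc m) E"
  shows "definable M m {x \<in> tuples m. \<forall>t. a < t \<longrightarrow> t < b \<longrightarrow> x @ [t] \<in> E}"
  by (intro definable_Collect definable_pred_mem[OF assms] definable_intros) simp

text \<open>Induction on the cell. Over a graph, project \<open>E\<close> to the base and lift the
  box found there. In a band, a single interval lies in the fibres over a full-dimensional part of
  the base; multiply the box found there by this interval.\<close>

lemma cell_relative_interior:
  assumes "cell M ks C" "E \<subseteq> C" "definable M (length ks) E" "dim_ge (length ks) (sum_list ks) E"
  shows "\<exists>p q. C \<inter> box_between p q \<noteq> {} \<and> C \<inter> box_between p q \<subseteq> E"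
  using assms
proof (induction arbitrary: E rule: cell.induct)
  case point
  then have "E = {[]}"
    by auto
  then show ?case
    by (intro exI[of _ "[]"]) (simp add: box_between_def)
next
  case (graph ks C f)
  let ?n = "length ks"
  define E' where "E' = {x \<in> tuples ?n. \<exists>t. x @ [t] \<in> E}"
  have E: "definable M (Suc ?n) E"
    using graph.prems by simp
  have "definable M ?n E'"
    unfolding E'_def by (intro definable_Collect definable_pred_mem[OF E] definable_intros) simp
  moreover have "E' \<subseteq> C"
    using graph.prems(1) unfolding E'_def by auto
  moreover have "dim_ge ?n (sum_list ks) E'"
  proof (rule dim_ge_subadditive)
    show "dim_ge (?n + Suc 0) (sum_list ks + 0) E"
      using graph.prems by simp
    show "z \<in> E'" if "length z = ?n" "length w = Suc 0" "z @ w \<in> E" for z w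
      using that unfolding E'_def by (auto simp: tuples_def length_Suc_conv)
    fix z
    have "{t. [t] \<in> {w. z @ w \<in> E}} \<subseteq> {f z}"
      using graph.prems(1) by auto
    then have "countable {t. [t] \<in> {w. z @ w \<in> E}}"
      by (rule countable_subset) simp
    then show "\<not> dim_ge (Suc 0) (Suc 0) {w. z @ w \<in> E}"
      unfolding dim_ge_1 by simp
  qed
  ultimately obtain p q x where pq: "C \<inter> box_between p q \<subseteq> E'" and x: "x \<in> C" "x \<in> box_between p q"
    using graph.IH by blast
  have E_eq: "y @ [f y] \<in> E" if "y \<in> E'" for y
    using that graph.prems(1) unfolding E'_def by auto
  \<comment> \<open>The height of the box only has to contain \<open>f x\<close>: \<open>E\<close>
    is already the whole graph over \<open>E'\<close>, so any bounds around \<open>f x\<close> will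
    do.\<close>
  let ?W = "{x @ [f x] |x. x \<in> C}" and ?B = "box_between (p @ [f x - 1]) (q @ [f x + 1])"
  have "x @ [f x] \<in> ?W \<inter> ?B"
    using x by (auto simp: box_between_snoc)
  moreover have "?W \<inter> ?B \<subseteq> E"
    using pq E_eq by (auto simp: box_between_snoc)
  ultimately show ?case
    by blast
next
  case (band ks C f g)
  let ?n = "length ks"
  let ?W = "{x @ [t] |x t. x \<in> C \<and> f x < ereal t \<and> ereal t < g x}"
  have E: "definable M (Suc ?n) E" and dimE: "dim_ge (Suc ?n) (Suc (sum_list ks)) E"
    using band.prems by simp_all
  have sub: "x \<in> C" if "x @ [t] \<in> E" for x t
    using band.prems(1) that by auto
  \<comment> \<open>The alternative of countable fibres would need a set of too large a dimension
    inside the base cell.\<close>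
  have "\<not> dim_ge ?n (Suc (sum_list ks)) {x. countable {t. x @ [t] \<in> E} \<and> (\<exists>t. x @ [t] \<in> E)}"
    using cell_dim(2)[OF band.hyps(1)] dim_ge_mono[of _ _ _ C] sub by blast
  then have "dim_ge ?n (sum_list ks) {x. uncountable {t. x @ [t] \<in> E}}"
    using dim_ge_last[OF dimE] by blast
  then obtain a b where ab: "a < b"
    and dim: "dim_ge ?n (sum_list ks) {x \<in> tuples ?n. \<forall>t. a < t \<longrightarrow> t < b \<longrightarrow> x @ [t] \<in> E}"
    by (rule dim_ge_uncountable_fibres[OF E])
  let ?E' = "{x \<in> tuples ?n. \<forall>t. a < t \<longrightarrow> t < b \<longrightarrow> x @ [t] \<in> E}"
  obtain t where t: "a < t" "t < b"
    using dense[OF ab] by blast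
  then have "?E' \<subseteq> C"
    using sub by blast
  then obtain p q where pq: "C \<inter> box_between p q \<noteq> {}" "C \<inter> box_between p q \<subseteq> ?E'"
    using band.IH[OF _ definable_fibres_contain_interval[OF E] dim] by blast
  then obtain x where x: "x \<in> ?E'" "x \<in> box_between p q"
    by blast
  let ?B = "box_between (p @ [a]) (q @ [b])"
  have "x @ [t] \<in> E" "x @ [t] \<in> ?B"
    using x t by (auto simp: box_between_snoc)
  then have "?W \<inter> ?B \<noteq> {}"
    using band.prems(1) by blast
  moreover have "?W \<inter> ?B \<subseteq> E"
    using pq(2) by (auto simp: box_between_snoc)
  ultimately show ?case
    by blast
qed

end

context o_minimal
begin

section \<open>Generic continuity of definable functions and existence of cells\<close>

lemma definable_Collect_graph:
  assumes C: "definable M n C" and \<Gamma>: "definable M (Suc n) \<Gamma>"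
  shows "definable M (Suc n) {x @ [t] |x t. x \<in> C \<and> x @ [t] \<in> \<Gamma>}"
proof -
  have "definable M (Suc n) {x @ [t] |x t. x \<in> tuples n \<and> (x \<in> C \<and> x @ [t] \<in> \<Gamma>)}"
    by (rule definable_Collect_snoc, intro definable_pred_conj definable_pred_mem[OF C]
        definable_pred_mem[OF \<Gamma>] definable_intros) simp_all
  also have "{x @ [t] |x t. x \<in> tuples n \<and> (x \<in> C \<and> x @ [t] \<in> \<Gamma>)} = {x @ [t] |x t. x \<in> C \<and> x @ [t] \<in> \<Gamma>}"
    using definable_subset_tuples[OF C] by blast
  finally show ?thesis .
qed

text \<open>If \<open>f\<close> is discontinuous at \<open>x\<close>, then some rational interval
  around \<open>f x\<close> has a preimage to which \<open>x\<close> is not relatively interior. For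
  each rational interval these points form a definable set without relative interior in the cell,
  hence of smaller dimension, and countably many such sets cannot exhaust the cell.\<close>

lemma generic_continuity:
  assumes cell: "cell M ks C" and \<Gamma>: "definable M (Suc (length ks)) {x @ [f x] |x. x \<in> C}"
  obtains E where "E \<subseteq> C" "definable M (length ks) E" "dim_ge (length ks) (sum_list ks) E"
    "\<And>C'. C' \<subseteq> E \<Longrightarrow> continuous_map (subtopology (tuple_topology (length ks)) C') euclideanreal f"
proof -
  define n where "n = length ks"
  define G where "G = {x @ [f x] |x. x \<in> C}"
  define V where "V a b x \<longleftrightarrow> (\<exists>s. x @ [s] \<in> G \<and> a < s \<and> s < b)" for a b x
  define near where "near a b x \<longleftrightarrow> (\<exists>p\<in>tuples n. \<exists>q\<in>tuples n. x \<in> box_between p q \<and>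
      (\<forall>y\<in>C. y \<in> box_between p q \<longrightarrow> V a b y))" for a b x
  \<comment> \<open>All real \<open>a\<close> and \<open>b\<close> are allowed, which keeps
    \<open>E\<close> definable; rational ones suffice to cover the rest of \<open>C\<close> by the
    sets \<open>N ab\<close>.\<close>
  define E where "E = {x \<in> tuples n. x \<in> C \<and> (\<forall>a b. V a b x \<longrightarrow> near a b x)}"
  define N where "N ab = {x \<in> tuples n. x \<in> C \<and> V (fst ab) (snd ab) x \<and> \<not> near (fst ab) (snd ab) x}" for ab
  have C: "definable M n C"
    unfolding n_def by (rule cell_definable[OF cell])
  have G: "definable M (Suc n) G"
    using \<Gamma> unfolding n_def G_def .
  have Vf: "V a b x \<longleftrightarrow> a < f x \<and> f x < b" if "x \<in> C" for a b x
    using that unfolding V_def G_def by auto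
  have E_def': "definable M n E"
    unfolding E_def near_def V_def
    by (intro definable_Collect definable_pred_ball[OF C] definable_pred_mem[OF C]
        definable_pred_mem[OF G] definable_intros) simp_all
  have N_def': "definable M n (N ab)" for ab
    unfolding N_def near_def V_def
    by (intro definable_Collect definable_pred_ball[OF C] definable_pred_mem[OF C]
        definable_pred_mem[OF G] definable_intros) simp_all
  have N_small: "\<not> dim_ge n (sum_list ks) (N ab)" for ab
  proof
    assume dim: "dim_ge n (sum_list ks) (N ab)"
    have "N ab \<subseteq> C"
      unfolding N_def by blast
    then obtain p q x where pq: "C \<inter> box_between p q \<subseteq> N ab" and x: "x \<in> C" "x \<in> box_between p q"
      using cell_relative_interior[OF cell _ N_def'[unfolded n_def] dim[unfolded n_def]] by blast
    have "x \<in> N ab"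
      using pq x by blast
    then have "p \<in> tuples n" "q \<in> tuples n"
      using box_between_length[OF x(2)] unfolding N_def tuples_def by auto
    moreover have "\<forall>y\<in>C. y \<in> box_between p q \<longrightarrow> V (fst ab) (snd ab) y"
      using pq unfolding N_def by blast
    ultimately have "near (fst ab) (snd ab) x"
      unfolding near_def using x(2) by blast
    then show False
      using \<open>x \<in> N ab\<close> unfolding N_def by blast
  qed
  have "C \<subseteq> E \<union> (\<Union>ab\<in>\<rat> \<times> \<rat>. N ab)"
  proof
    fix x assume x: "x \<in> C"
    show "x \<in> E \<union> (\<Union>ab\<in>\<rat> \<times> \<rat>. N ab)"
    proof (cases "x \<in> E")
      case False
      have xt: "x \<in> tuples n"
        using x definable_subset_tuples[OF C] by blast
      then obtain a b where ab: "V a b x" "\<not> near a b x"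
        using False x unfolding E_def by blast
      have fx: "a < f x" "f x < b"
        using ab(1) Vf[OF x] by auto
      obtain a' where a': "a' \<in> \<rat>" "a < a'" "a' < f x"
        using Rats_dense_in_real[OF fx(1)] by blast
      obtain b' where b': "b' \<in> \<rat>" "f x < b'" "b' < b"
        using Rats_dense_in_real[OF fx(2)] by blast
      \<comment> \<open>\<open>near\<close> is inherited by larger intervals, so its failure passes
        to the smaller rational interval.\<close>
      have "V a' b' y \<Longrightarrow> V a b y" for y
        using a'(2) b'(3) unfolding V_def by force
      then have "\<not> near a' b' x"
        using ab(2) unfolding near_def by blast
      moreover have "V a' b' x"
        using Vf[OF x] a' b' by simp
      ultimately have "x \<in> N (a', b')"
        using x xt unfolding N_def by simp
      then show ?thesis
        using a'(1) b'(1) by blast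
    qed simp
  qed
  then have "dim_ge n (sum_list ks) (E \<union> (\<Union>ab\<in>\<rat> \<times> \<rat>. N ab))"
    using cell_dim(1)[OF cell] dim_ge_mono unfolding n_def by blast
  moreover have "\<not> dim_ge n (sum_list ks) (\<Union>ab\<in>\<rat> \<times> \<rat>. N ab)"
  proof
    assume "dim_ge n (sum_list ks) (\<Union>ab\<in>\<rat> \<times> \<rat>. N ab)"
    then have "\<exists>ab\<in>\<rat> \<times> \<rat>. dim_ge n (sum_list ks) (N ab)"
      by (rule dim_ge_UN[rotated]) (simp add: countable_rat)
    then show False
      using N_small by blast
  qed
  ultimately have dimE: "dim_ge n (sum_list ks) E"
    using dim_ge_Un by blast
  \<comment> \<open>The boxes control \<open>f\<close> on all of \<open>C\<close>, so continuity at
    the points of \<open>E\<close> restricts to every subset of \<open>E\<close>.\<close>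
  have "continuous_map (subtopology (tuple_topology n) C') euclideanreal f" if "C' \<subseteq> E" for C'
  proof -
    let ?X = "subtopology (tuple_topology n) C'"
    have "openin ?X {x \<in> topspace ?X. f x \<in> U}" if "open U" for U
    proof (subst openin_subopen, intro ballI)
      fix x assume "x \<in> {x \<in> topspace ?X. f x \<in> U}"
      then have x: "x \<in> topspace (tuple_topology n)" "x \<in> C'" "f x \<in> U"
        by auto
      then obtain \<epsilon> where e: "\<epsilon> > 0" "ball (f x) \<epsilon> \<subseteq> U"
        using \<open>open U\<close> open_contains_ball by metis
      have xE: "x \<in> C" "V (f x - \<epsilon>) (f x + \<epsilon>) x \<longrightarrow> near (f x - \<epsilon>) (f x + \<epsilon>) x"
        using x(2) \<open>C' \<subseteq> E\<close> unfolding E_def by blast+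
      then have "near (f x - \<epsilon>) (f x + \<epsilon>) x"
        using Vf e(1) by simp
      then obtain p q where pq: "p \<in> tuples n" "x \<in> box_between p q"
        "\<And>y. y \<in> C \<Longrightarrow> y \<in> box_between p q \<Longrightarrow> f x - \<epsilon> < f y \<and> f y < f x + \<epsilon>"
        unfolding near_def using Vf by blast
      have B: "openin (tuple_topology n) (box_between p q)"
        using openin_box_between[of p q] pq(1) by (simp add: tuples_def)
      have "openin ?X (C' \<inter> box_between p q)"
        using B by (metis openin_subtopology_Int2)
      moreover have "x \<in> C' \<inter> box_between p q"
        using x pq by blast
      moreover have "C' \<inter> box_between p q \<subseteq> {x \<in> topspace ?X. f x \<in> U}"
      proof
        fix y assume y: "y \<in> C' \<inter> box_between p q"
        then have "y \<in> C"
          using \<open>C' \<subseteq> E\<close> unfolding E_def by blast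
        then have "f y \<in> U"
          using pq(3)[of y] y e(2) by (auto simp: dist_real_def subset_iff)
        moreover have "y \<in> topspace ?X"
          using y openin_subset[OF B] by auto
        ultimately show "y \<in> {x \<in> topspace ?X. f x \<in> U}"
          by blast
      qed
      ultimately show "\<exists>T. openin ?X T \<and> x \<in> T \<and> T \<subseteq> {x \<in> topspace ?X. f x \<in> U}"
        by blast
    qed
    then show ?thesis
      unfolding continuous_map_def by simp
  qed
  moreover have "E \<subseteq> C"
    unfolding E_def by blast
  ultimately show ?thesis
    using E_def' dimE unfolding n_def by (intro that)
qed

text \<open>Induction on \<open>m\<close>, split by the size of the fibres in the last coordinate.
  Over uncountable fibres, a cell of the base times a common interval is a band inside
  \<open>A\<close>. Over countable, hence finite, fibres the least element is a definable function,
  and its graph over a cell on which it is continuous lies inside \<open>A\<close>.\<close>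

lemma cell_of_dim_ge:
  "definable M m A \<Longrightarrow> dim_ge m k A \<Longrightarrow> \<exists>ks C. cell M ks C \<and> C \<subseteq> A \<and> length ks = m \<and> k \<le> sum_list ks"
proof (induction m arbitrary: k A)
  case 0
  then have "cell M [] {[]}" "{[]} \<subseteq> A" "k = 0"
    by (auto intro: cell.point)
  then show ?case
    by (intro exI[of _ "[]"] exI[of _ "{[]}"]) simp
next
  case (Suc m)
  note A = \<open>definable M (Suc m) A\<close>
  let ?F = "{x. countable {t. x @ [t] \<in> A} \<and> (\<exists>t. x @ [t] \<in> A)}"
  let ?U = "{x. uncountable {t. x @ [t] \<in> A}}"
  \<comment> \<open>Subtraction is truncated: for \<open>k = 0\<close> the second alternative only
    asks that \<open>?U\<close> contain a tuple of length \<open>m\<close>.\<close>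
  have "dim_ge m k ?F \<or> dim_ge m (k - 1) ?U"
  proof (cases k)
    case 0
    obtain y where "y \<in> A" "length y = Suc m"
      using dim_ge_nonempty[OF Suc.prems(2)] by blast
    then obtain x t where xt: "x @ [t] \<in> A" "length x = m"
      by (metis length_Suc_conv_rev)
    show ?thesis
    proof (cases "countable {t. x @ [t] \<in> A}")
      case True
      then have "dim_ge m 0 ?F"
        unfolding dim_ge_0 using xt by blast
      then show ?thesis
        using 0 by simp
    next
      case False
      then have "dim_ge m 0 ?U"
        unfolding dim_ge_0 using xt(2) by blast
      then show ?thesis
        using 0 by simp
    qed
  next
    case (Suc j)
    then show ?thesis
      using dim_ge_last[of m j A] Suc.prems(2) by simp
  qed
  then show ?case
  proof
    assume "dim_ge m (k - 1) ?U"
    then obtain a b where ab: "a < b"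
      and dim: "dim_ge m (k - 1) {x \<in> tuples m. \<forall>t. a < t \<longrightarrow> t < b \<longrightarrow> x @ [t] \<in> A}"
      by (rule dim_ge_uncountable_fibres[OF A])
    obtain ks C where C: "cell M ks C" "C \<subseteq> {x \<in> tuples m. \<forall>t. a < t \<longrightarrow> t < b \<longrightarrow> x @ [t] \<in> A}"
      "length ks = m" "k - 1 \<le> sum_list ks"
      using Suc.IH[OF definable_fibres_contain_interval[OF A] dim] by blast
    have bound: "cell_bound M (length ks) C (\<lambda>_. ereal c)" for c
    proof -
      note C_def = cell_definable[OF C(1)]
      have "definable M (Suc (length ks)) {x @ [t] |x t. x \<in> tuples (length ks) \<and> (x \<in> C \<and> t = c)}"
        by (rule definable_Collect_snoc, intro definable_pred_conj definable_pred_mem[OF C_def]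
            definable_intros) simp
      also have "{x @ [t] |x t. x \<in> tuples (length ks) \<and> (x \<in> C \<and> t = c)} = {x @ [c] |x. x \<in> C}"
        using cell_subset_tuples[OF C(1)] by blast
      finally have "definable_continuous M (length ks) C (\<lambda>_. c)"
        unfolding definable_continuous_def by simp
      then show ?thesis
        unfolding cell_bound_def by blast
    qed
    have "cell M (ks @ [1]) {x @ [t] |x t. x \<in> C \<and> ereal a < ereal t \<and> ereal t < ereal b}"
      using ab by (intro cell.band C(1) bound) simp
    moreover have "{x @ [t] |x t. x \<in> C \<and> ereal a < ereal t \<and> ereal t < ereal b} \<subseteq> A"
      using C(2) by auto
    ultimately show ?thesis
      using C(3,4) by (intro exI[of _ "ks @ [1]"] exI conjI) auto
  next
    assume dimF: "dim_ge m k ?F"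
    have len: "x \<in> tuples m" if "x @ [t] \<in> A" for x t
      using that definable_subset_tuples[OF A] by (auto simp: tuples_def)
    define F where "F = {x \<in> tuples m. (\<not> uncountable {t. x @ [t] \<in> A}) \<and> (\<exists>t. x @ [t] \<in> A)}"
    have "F = ?F"
      unfolding F_def using len by blast
    have F: "definable M m F"
      unfolding F_def
      by (intro definable_Collect definable_pred_mem[OF A] definable_intros) simp_all
    \<comment> \<open>The least elements of the fibres, described by a formula; over
      \<open>F\<close> this set is the graph of \<open>f\<close>.\<close>
    define \<Gamma> where "\<Gamma> = {x @ [t] |x t. x \<in> tuples m \<and> (x @ [t] \<in> A \<and> (\<forall>s. x @ [s] \<in> A \<longrightarrow> \<not> s < t))}"
    have \<Gamma>: "definable M (Suc m) \<Gamma>"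
      unfolding \<Gamma>_def
      by (rule definable_Collect_snoc, intro definable_pred_mem[OF A] definable_intros) simp_all
    define f where "f x = Min {t. x @ [t] \<in> A}" for x
    have f: "x @ [t] \<in> \<Gamma> \<longleftrightarrow> t = f x" if "x \<in> F" for x t
    proof -
      have x: "x \<in> tuples m" "countable {t. x @ [t] \<in> A}" "{t. x @ [t] \<in> A} \<noteq> {}"
        using that unfolding F_def by auto
      have "definable_pred M (\<lambda>e. x @ [e 0] \<in> A)"
        using x(1) by (intro definable_pred_mem[OF A] definable_intros) (simp add: tuples_def)
      then have "finite {t. x @ [t] \<in> A}"
        using definable_countable_finite[OF definable_line x(2)] by simp
      then have "t = f x \<longleftrightarrow> x @ [t] \<in> A \<and> (\<forall>s. x @ [s] \<in> A \<longrightarrow> t \<le> s)"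
        unfolding f_def using Min_eq_iff[of "{t. x @ [t] \<in> A}" t] x(3) by auto
      then show ?thesis
        unfolding \<Gamma>_def using x(1) by (auto simp: not_less)
    qed
    have graph: "definable M (Suc m) {x @ [f x] |x. x \<in> C}" if "definable M m C" "C \<subseteq> F" for C
    proof -
      have "{x @ [f x] |x. x \<in> C} = {x @ [t] |x t. x \<in> C \<and> x @ [t] \<in> \<Gamma>}"
        using f that(2) by blast
      then show ?thesis
        using definable_Collect_graph[OF that(1) \<Gamma>] by simp
    qed
    obtain ks C where C: "cell M ks C" "C \<subseteq> F" "length ks = m" "k \<le> sum_list ks"
      using Suc.IH[OF F] dimF unfolding \<open>F = ?F\<close> by blast
    have C_def: "definable M m C"
      using cell_definable[OF C(1)] C(3) by simp
    obtain E where E: "E \<subseteq> C" "definable M m E" "dim_ge m (sum_list ks) E"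
      and cont: "\<And>C'. C' \<subseteq> E \<Longrightarrow> continuous_map (subtopology (tuple_topology m) C') euclideanreal f"
      using generic_continuity[OF C(1), unfolded C(3), OF graph[OF C_def C(2)]] by metis
    \<comment> \<open>\<open>E\<close> need not be a cell, so the induction hypothesis is used a
      second time. Since \<open>E\<close> has the full dimension of \<open>C\<close>, nothing is
      lost.\<close>
    obtain ks' C' where C': "cell M ks' C'" "C' \<subseteq> E" "length ks' = m" "sum_list ks \<le> sum_list ks'"
      using Suc.IH[OF E(2,3)] by blast
    have "C' \<subseteq> F"
      using C'(2) E(1) C(2) by blast
    then have "definable_continuous M (length ks') C' f"
      unfolding definable_continuous_def using graph cell_definable[OF C'(1)] cont[OF C'(2)] C'(3)
      by simp
    then have "cell M (ks' @ [0]) {x @ [f x] |x. x \<in> C'}"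
      by (rule cell.graph[OF C'(1)])
    moreover have "{x @ [f x] |x. x \<in> C'} \<subseteq> A"
    proof -
      have "x @ [f x] \<in> A" if "x \<in> C'" for x
        using f[of x "f x"] that \<open>C' \<subseteq> F\<close> unfolding \<Gamma>_def by auto
      then show ?thesis
        by blast
    qed
    ultimately show ?thesis
      using C'(3,4) C(4) by (intro exI[of _ "ks' @ [0]"] exI conjI) auto
  qed
qed

section \<open>Comparison with the dimension by cells\<close>

lemma odim_ge:
  assumes "definable M m A" "dim_ge m k A"
  shows "ereal (real k) \<le> odim M A"
proof -
  obtain ks C where C: "cell M ks C" "C \<subseteq> A" "k \<le> sum_list ks"
    using cell_of_dim_ge[OF assms] by blast
  then have "ereal (real k) \<le> ereal (real (sum_list ks))"
    by simp
  also have "\<dots> \<le> odim M A"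
    unfolding odim_def using C by (intro SUP_upper) blast
  finally show ?thesis .
qed

lemma dim_ge_cell_subset:
  assumes "A \<subseteq> tuples m" "cell M ks C" "C \<subseteq> A" "k \<le> sum_list ks"
  shows "dim_ge m k A"
proof -
  obtain x where "x \<in> C"
    using cell_nonempty[OF assms(2)] by blast
  then have "length ks = m"
    using subsetD[OF cell_subset_tuples[OF assms(2)]] subsetD[OF assms(1)] subsetD[OF assms(3)]
    unfolding tuples_def by auto
  then have "dim_ge m (sum_list ks) C"
    using cell_dim(1)[OF assms(2)] by simp
  then show ?thesis
    by (rule dim_ge_antimono[OF dim_ge_mono[OF _ assms(3)] assms(4)])
qed

lemma odim_le:
  assumes "A \<subseteq> tuples m" "\<not> dim_ge m (Suc k) A"
  shows "odim M A \<le> ereal (real k)"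
proof -
  have "ereal (real (sum_list ks)) \<le> ereal (real k)"
    if "ks \<in> {ks. \<exists>C. cell M ks C \<and> C \<subseteq> A}" for ks
    using that dim_ge_cell_subset[OF assms(1), of ks _ "Suc k"] assms(2) by fastforce
  then show ?thesis
    unfolding odim_def by (rule SUP_least)
qed

lemma dim_ge_of_odim:
  assumes "A \<subseteq> tuples m" "ereal (real k) \<le> odim M A"
  shows "dim_ge m k A"
proof (cases k)
  case 0
  have "{ks. \<exists>C. cell M ks C \<and> C \<subseteq> A} \<noteq> {}"
  proof
    assume "{ks. \<exists>C. cell M ks C \<and> C \<subseteq> A} = {}"
    then have "odim M A = -\<infinity>"
      unfolding odim_def by (simp only: image_empty Sup_empty bot_ereal_def)
    then show False
      using assms(2) by simp
  qed
  then show ?thesis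
    using 0 dim_ge_cell_subset[OF assms(1)] by blast
next
  case (Suc j)
  show ?thesis
  proof (rule ccontr)
    assume "\<not> dim_ge m k A"
    then have "odim M A \<le> ereal (real j)"
      using odim_le[OF assms(1)] Suc by simp
    then have "ereal (real k) \<le> ereal (real j)"
      using assms(2) by (rule order_trans[rotated])
    then show False
      using Suc by simp
  qed
qed

end

section \<open>Second countability\<close>

lemma dim_ge_exact:
  assumes "A \<subseteq> tuples m" "A \<noteq> {}"
  obtains k where "dim_ge m k A" "\<not> dim_ge m (Suc k) A"
proof -
  have "\<exists>k. dim_ge m k A \<and> \<not> dim_ge m (Suc k) A"
  proof (rule ccontr)
    assume "\<not> ?thesis"
    then have step: "dim_ge m k A \<Longrightarrow> dim_ge m (Suc k) A" for k
      by blast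
    have zero: "dim_ge m 0 A"
      unfolding dim_ge_0 using assms by (auto simp: tuples_def)
    have "dim_ge m k A" for k
      by (induction k) (fact zero, rule step)
    then show False
      using dim_ge_le[of m "Suc m" A] by simp
  qed
  then show thesis
    using that by blast
qed

lemma dim_ge_product:
  assumes "dim_ge m1 d1 A" "dim_ge m2 d2 B"
  shows "dim_ge (m1 + m2) (d1 + d2) {a @ b |a b. a \<in> A \<and> b \<in> B}"
proof (rule dim_ge_superadditive[OF assms(1)])
  fix z assume "z \<in> A"
  then show "dim_ge m2 d2 {w. z @ w \<in> {a @ b |a b. a \<in> A \<and> b \<in> B}}"
    by (intro dim_ge_mono[OF assms(2)]) blast
qed

lemma not_dim_ge_product:
  assumes "A \<subseteq> tuples m1" "\<not> dim_ge m1 (Suc d1) A" "\<not> dim_ge m2 (Suc d2) B"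
  shows "\<not> dim_ge (m1 + m2) (Suc (d1 + d2)) {a @ b |a b. a \<in> A \<and> b \<in> B}"
proof
  let ?P = "{a @ b |a b. a \<in> A \<and> b \<in> B}"
  assume "dim_ge (m1 + m2) (Suc (d1 + d2)) ?P"
  then have P: "dim_ge (m1 + m2) (Suc d1 + d2) ?P"
    by simp
  have split: "z \<in> A \<and> w \<in> B" if "z @ w \<in> ?P" "length z = m1"
    for z w :: "real list"
  proof -
    have "\<exists>a b. z @ w = a @ b \<and> a \<in> A \<and> b \<in> B"
      using that(1) by simp
    then obtain a b where ab: "z @ w = a @ b" "a \<in> A" "b \<in> B"
      by (elim exE conjE)
    then have "length a = m1"
      using assms(1) by (auto simp: tuples_def)
    then show ?thesis
      using ab that(2) by simp
  qed
  have "dim_ge m1 (Suc d1) A"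
  proof (rule dim_ge_subadditive[OF P])
    show "z \<in> A" if "length z = m1" "z @ w \<in> ?P" for z w
      using split that by blast
    fix z :: "real list" assume "length z = m1"
    then have "{w. z @ w \<in> ?P} \<subseteq> B"
      using split by blast
    then show "\<not> dim_ge m2 (Suc d2) {w. z @ w \<in> ?P}"
      using assms(3) dim_ge_mono by blast
  qed
  then show False
    using assms(2) by blast
qed

lemma definable_product:
  assumes A: "definable M m1 A" and B: "definable M m2 B"
  shows "definable M (m1 + m2) {a @ b |a b. a \<in> A \<and> b \<in> B}"
proof -
  have "definable M (m1 + m2) {x \<in> tuples (m1 + m2). take m1 x \<in> A \<and> drop m1 x \<in> B}"
    by (intro definable_Collect definable_pred_conj definable_pred_mem[OF A]
        definable_pred_mem[OF B] definable_intros) simp_all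
  also have "{x \<in> tuples (m1 + m2). take m1 x \<in> A \<and> drop m1 x \<in> B} = {a @ b |a b. a \<in> A \<and> b \<in> B}"
    (is "?L = ?R")
  proof
    show "?L \<subseteq> ?R"
    proof
      fix x assume x: "x \<in> ?L"
      have "x = take m1 x @ drop m1 x"
        by simp
      then show "x \<in> ?R"
        using x by blast
    qed
    have "length a = m1" if "a \<in> A" for a
      using definable_subset_tuples[OF A] that by (auto simp: tuples_def)
    moreover have "length b = m2" if "b \<in> B" for b
      using definable_subset_tuples[OF B] that by (auto simp: tuples_def)
    ultimately show "?R \<subseteq> ?L"
      by (auto simp: tuples_def)
  qed
  finally show ?thesis .
qed

lemma definable_singleton: "definable M 1 {[c]}"
proof -
  have "definable M (Suc 0) {x @ [t] |x t. x \<in> tuples 0 \<and> t = c}"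
    by (intro definable_Collect_snoc definable_intros)
  then show ?thesis
    by (simp add: tuples_def)
qed

text \<open>Replaces the formula and its parameters by one definable set \<open>S\<close> of pairs,
  so that all fibres of the family are handled through membership in \<open>S\<close>.\<close>

lemma definable_family_iff:
  "definable_family M n m B U \<longleftrightarrow>
    definable M m B \<and> (\<exists>S. definable M (n + m) S \<and> (\<forall>b\<in>B. U b = {a \<in> tuples n. a @ b \<in> S}))"
proof -
  have eq: "{a \<in> tuples n. sat M (assign (a @ b) p) \<phi>} =
      {a \<in> tuples n. a @ b \<in> {x \<in> tuples (n + m). sat M (assign x p) \<phi>}}"
    if "b \<in> tuples m" for b p and \<phi>
    using that by (auto simp: tuples_def)
  show ?thesis
  proof
    assume "definable_family M n m B U"
    then obtain \<phi> p where *: "definable M m B" "wf_formula M \<phi>"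
      "\<And>b. b \<in> B \<Longrightarrow> U b = {a \<in> tuples n. sat M (assign (a @ b) p) \<phi>}"
      unfolding definable_family_def by blast
    let ?S = "{x \<in> tuples (n + m). sat M (assign x p) \<phi>}"
    have "definable M (n + m) ?S"
      unfolding definable_def using *(2) by blast
    moreover have "U b = {a \<in> tuples n. a @ b \<in> ?S}" if "b \<in> B" for b
      using *(3)[OF that] eq[of b] that definable_subset_tuples[OF *(1)] by blast
    ultimately show "definable M m B \<and>
        (\<exists>S. definable M (n + m) S \<and> (\<forall>b\<in>B. U b = {a \<in> tuples n. a @ b \<in> S}))"
      using *(1) by blast
  next
    assume "definable M m B \<and>
        (\<exists>S. definable M (n + m) S \<and> (\<forall>b\<in>B. U b = {a \<in> tuples n. a @ b \<in> S}))"
    then obtain S \<phi> p where *: "definable M m B" "\<And>b. b \<in> B \<Longrightarrow> U b = {a \<in> tuples n. a @ b \<in> S}"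
      "wf_formula M \<phi>" "S = {x \<in> tuples (n + m). sat M (assign x p) \<phi>}"
      unfolding definable_def[of M "n + m"] by blast
    have "U b = {a \<in> tuples n. sat M (assign (a @ b) p) \<phi>}" if "b \<in> B" for b
      using *(2)[OF that] eq[of b] that definable_subset_tuples[OF *(1)] *(4) by blast
    then show "definable_family M n m B U"
      unfolding definable_family_def using *(1,3) by blast
  qed
qed

lemma basis_for_openin: "basis_for T (U ` B) \<Longrightarrow> b \<in> B \<Longrightarrow> openin T (U b)"
  by (simp add: basis_for_def)

lemma basis_for_nhd:
  assumes "basis_for T (U ` B)" "openin T W" "x \<in> W"
  obtains b where "b \<in> B" "x \<in> U b" "U b \<subseteq> W"
proof -
  have "\<exists>V\<in>U ` B. x \<in> V \<and> V \<subseteq> W"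
    using assms(1)[unfolded basis_for_def, THEN conjunct2] assms(2,3) by simp
  then show thesis
    using that by (elim bexE imageE conjE) simp
qed

section \<open>From definable second countability to a countable basis\<close>

lemma (in o_minimal) definably_second_countable_imp:
  assumes "definably_second_countable M n T"
  shows "second_countable T"
proof -
  obtain m B U where basis: "definable_basis M n T m B U"
    and full: "\<And>x b. x \<in> topspace T \<Longrightarrow> b \<in> B \<Longrightarrow> x \<in> U b \<Longrightarrow>
      odim M {c \<in> B. x \<in> U c \<and> U c \<subseteq> U b} = odim M B"
    using assms unfolding definably_second_countable_def by blast
  obtain S where B: "definable M m B" and S: "definable M (n + m) S"
    and U: "\<And>b. b \<in> B \<Longrightarrow> U b = {a \<in> tuples n. a @ b \<in> S}"
    using basis unfolding definable_basis_def definable_family_iff by blast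
  have T: "basis_for T (U ` B)"
    using basis unfolding definable_basis_def by blast
  note B_tup = definable_subset_tuples[OF B]
  have "\<exists>D. countable D \<and> D \<subseteq> B \<and>
      (\<forall>x b. x \<in> topspace T \<longrightarrow> b \<in> B \<longrightarrow> x \<in> U b \<longrightarrow> (\<exists>c\<in>D. x \<in> U c \<and> U c \<subseteq> U b))"
  \<comment> \<open>An empty \<open>B\<close> has dimension minus infinity and no exact value
    \<open>k\<close>; the claim is then vacuous.\<close>
  proof (cases "B = {}")
    case False
    obtain k where k: "dim_ge m k B" "\<not> dim_ge m (Suc k) B"
      using dim_ge_exact[OF B_tup False] by blast
    obtain D where D: "countable D" "D \<subseteq> B"
      "\<And>A. definable M m A \<Longrightarrow> A \<subseteq> B \<Longrightarrow> dim_ge m k A \<Longrightarrow> A \<inter> D \<noteq> {}"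
      using countable_transversal[OF B k(2)] by blast
    have "\<exists>c\<in>D. x \<in> U c \<and> U c \<subseteq> U b" if "x \<in> topspace T" "b \<in> B" "x \<in> U b" for x b
    proof -
      let ?A = "{c \<in> B. x \<in> U c \<and> U c \<subseteq> U b}"
      have x: "x \<in> tuples n"
        using that(2,3) U by blast
      have len: "length x = n" "length b = m"
        using x that(2) B_tup by (auto simp: tuples_def)
      \<comment> \<open>Inclusion of basic sets is expressed by memberships in \<open>S\<close>,
        which makes \<open>?A\<close> definable and hence subject to the transversal
        \<open>D\<close>.\<close>
      have "definable M m {c \<in> tuples m. c \<in> B \<and> x @ c \<in> S \<and> (\<forall>a\<in>tuples n. a @ c \<in> S \<longrightarrow> a @ b \<in> S)}"
        by (intro definable_Collect definable_pred_mem[OF B] definable_pred_mem[OF S] definable_intros)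
          (simp_all add: len)
      also have "{c \<in> tuples m. c \<in> B \<and> x @ c \<in> S \<and> (\<forall>a\<in>tuples n. a @ c \<in> S \<longrightarrow> a @ b \<in> S)} = ?A"
        using B_tup U x that(2) by auto
      finally have A: "definable M m ?A" .
      have "ereal (real k) \<le> odim M ?A"
        unfolding full[OF that] by (rule odim_ge[OF B k(1)])
      then have "dim_ge m k ?A"
        by (rule dim_ge_of_odim[OF definable_subset_tuples[OF A]])
      then have "?A \<inter> D \<noteq> {}"
        using D(3)[OF A] by blast
      then show ?thesis
        by blast
    qed
    then show ?thesis
      using D(1,2) by blast
  qed blast
  then obtain D where D: "countable D" "D \<subseteq> B"
    "\<And>x b. x \<in> topspace T \<Longrightarrow> b \<in> B \<Longrightarrow> x \<in> U b \<Longrightarrow> \<exists>c\<in>D. x \<in> U c \<and> U c \<subseteq> U b"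
    by blast
  have "\<exists>V\<in>U ` D. x \<in> V \<and> V \<subseteq> W" if W: "openin T W" "x \<in> W" for W x
  proof -
    obtain b where b: "b \<in> B" "x \<in> U b" "U b \<subseteq> W"
      using basis_for_nhd[OF T W] by metis
    have "x \<in> topspace T"
      using W openin_subset by blast
    then obtain c where "c \<in> D" "x \<in> U c" "U c \<subseteq> U b"
      using D(3) b(1,2) by blast
    then show ?thesis
      using b(3) by blast
  qed
  moreover have "\<forall>V\<in>U ` D. openin T V"
    using basis_for_openin[OF T] D(2) by blast
  ultimately show ?thesis
    unfolding second_countable_def using D(1) countable_image by meson
qed

text \<open>For each pair \<open>V\<close>, \<open>W\<close> from a countable basis with some
  \<open>U b\<close> between them, choose one such \<open>b\<close>. Given \<open>x\<close> in an
  open set, fit \<open>W\<close>, then some \<open>U b\<close>, then \<open>V\<close> around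
  \<open>x\<close>; the index chosen for this pair is the one needed.\<close>

lemma second_countable_subbasis:
  assumes "second_countable T" "basis_for T (U ` B)"
  obtains D where "countable D" "D \<subseteq> B" "basis_for T (U ` D)"
proof -
  obtain \<B> where \<B>': "countable \<B>" "\<forall>V\<in>\<B>. openin T V"
    "\<forall>W x. openin T W \<and> x \<in> W \<longrightarrow> (\<exists>V\<in>\<B>. x \<in> V \<and> V \<subseteq> W)"
    using assms(1) unfolding second_countable_def by (elim exE conjE)
  have \<B>: "countable \<B>" "\<And>V. V \<in> \<B> \<Longrightarrow> openin T V"
    "\<And>W x. openin T W \<Longrightarrow> x \<in> W \<Longrightarrow> \<exists>V\<in>\<B>. x \<in> V \<and> V \<subseteq> W"
    using \<B>' by simp_all
  define P where "P = {(V, W) \<in> \<B> \<times> \<B>. \<exists>b\<in>B. V \<subseteq> U b \<and> U b \<subseteq> W}"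
  have "\<forall>VW\<in>P. \<exists>b. b \<in> B \<and> fst VW \<subseteq> U b \<and> U b \<subseteq> snd VW"
    unfolding P_def by auto
  from bchoice[OF this] obtain h where
    h: "\<And>VW. VW \<in> P \<Longrightarrow> h VW \<in> B \<and> fst VW \<subseteq> U (h VW) \<and> U (h VW) \<subseteq> snd VW"
    by blast
  have "P \<subseteq> \<B> \<times> \<B>"
    unfolding P_def by blast
  then have "countable P"
    using countable_SIGMA \<B>(1) countable_subset by metis
  have "h ` P \<subseteq> B"
    using h by blast
  moreover have "basis_for T (U ` h ` P)"
    unfolding basis_for_def
  proof (intro conjI allI impI ballI)
    show "openin T V" if "V \<in> U ` h ` P" for V
      using that \<open>h ` P \<subseteq> B\<close> basis_for_openin[OF assms(2)] by blast
    fix W x assume "openin T W \<and> x \<in> W"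
    then obtain W' where W': "W' \<in> \<B>" "x \<in> W'" "W' \<subseteq> W"
      using \<B>(3) by blast
    obtain b where b: "b \<in> B" "x \<in> U b" "U b \<subseteq> W'"
      using basis_for_nhd[OF assms(2) \<B>(2)[OF W'(1)] W'(2)] by metis
    have "openin T (U b)"
      using basis_for_openin[OF assms(2) b(1)] .
    then obtain V where V: "V \<in> \<B>" "x \<in> V" "V \<subseteq> U b"
      using \<B>(3) b(2) by blast
    have "(V, W') \<in> P"
      unfolding P_def using V b W' by blast
    then have "x \<in> U (h (V, W'))" "U (h (V, W')) \<subseteq> W"
      using h[of "(V, W')"] V W' by auto
    then show "\<exists>V\<in>U ` h ` P. x \<in> V \<and> V \<subseteq> W"
      using \<open>(V, W') \<in> P\<close> by blast
  qed
  ultimately show ?thesis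
    using that[of "h ` P"] \<open>countable P\<close> by blast
qed

section \<open>Covering families of full dimension\<close>

locale definable_space = o_minimal M for M :: "('f, 'r, real) fo_structure" +
  fixes n m :: nat and T :: "real list topology" and B S :: "real list set"
  assumes B: "definable M m B" and S: "definable M (n + m) S"
    and basis: "basis_for T ((\<lambda>b. {a \<in> tuples n. a @ b \<in> S}) ` B)"
begin

abbreviation U :: "real list \<Rightarrow> real list set" where
  "U b \<equiv> {a \<in> tuples n. a @ b \<in> S}"

lemma U_nhd:
  assumes "openin T W" "x \<in> W"
  obtains b where "b \<in> B" "x \<in> U b" "U b \<subseteq> W"
  by (rule basis_for_nhd[OF basis assms]) (rule that)

lemma U_open: "b \<in> B \<Longrightarrow> openin T (U b)"
  using basis_for_openin[OF basis] by simp

lemma topspace_eq: "topspace T = {x \<in> tuples n. \<exists>b\<in>B. x @ b \<in> S}"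
proof
  show "topspace T \<subseteq> {x \<in> tuples n. \<exists>b\<in>B. x @ b \<in> S}"
  proof
    fix x assume "x \<in> topspace T"
    then obtain b where "b \<in> B" "x \<in> U b" "U b \<subseteq> topspace T"
      by (rule U_nhd[OF openin_topspace]) (rule that)
    then show "x \<in> {x \<in> tuples n. \<exists>b\<in>B. x @ b \<in> S}"
      by blast
  qed
  show "{x \<in> tuples n. \<exists>b\<in>B. x @ b \<in> S} \<subseteq> topspace T"
    using U_open[THEN openin_subset] by blast
qed

lemma B_length: "b \<in> B \<Longrightarrow> length b = m"
  using definable_subset_tuples[OF B] by (auto simp: tuples_def)

lemma definable_topspace: "definable M n (topspace T)"
  unfolding topspace_eq
  by (intro definable_Collect definable_pred_bex[OF B] definable_pred_mem[OF S] definable_intros) simp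

text \<open>The dimension condition is imposed only at the points of \<open>Y\<close>, and \<open>d\<close> is the dimension of \<open>B'\<close>.\<close>

definition covered :: "real list set \<Rightarrow> bool" where
  "covered Y \<longleftrightarrow> (\<exists>m' d B' S'. definable M m' B' \<and> definable M (n + m') S' \<and>
     (\<forall>c\<in>B'. openin T {a \<in> tuples n. a @ c \<in> S'}) \<and> \<not> dim_ge m' (Suc d) B' \<and>
     (\<forall>y\<in>Y. \<forall>V. openin T V \<longrightarrow> y \<in> V \<longrightarrow>
        dim_ge m' d {c \<in> B'. y @ c \<in> S' \<and> {a \<in> tuples n. a @ c \<in> S'} \<subseteq> V}))"

lemma coveredI:
  assumes "definable M m' B'" "definable M (n + m') S'"
    "\<And>c. c \<in> B' \<Longrightarrow> openin T {a \<in> tuples n. a @ c \<in> S'}" "\<not> dim_ge m' (Suc d) B'"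
    "\<And>y V. y \<in> Y \<Longrightarrow> openin T V \<Longrightarrow> y \<in> V \<Longrightarrow>
      dim_ge m' d {c \<in> B'. y @ c \<in> S' \<and> {a \<in> tuples n. a @ c \<in> S'} \<subseteq> V}"
  shows "covered Y"
  unfolding covered_def
  by (rule exI[of _ m'], rule exI[of _ d], rule exI[of _ B'], rule exI[of _ S'])
    (intro conjI ballI allI impI assms)

lemma coveredE:
  assumes "covered Y"
  obtains m' d B' S' where "definable M m' B'" "definable M (n + m') S'"
    "\<And>c. c \<in> B' \<Longrightarrow> openin T {a \<in> tuples n. a @ c \<in> S'}" "\<not> dim_ge m' (Suc d) B'"
    "\<And>y V. y \<in> Y \<Longrightarrow> openin T V \<Longrightarrow> y \<in> V \<Longrightarrow>
      dim_ge m' d {c \<in> B'. y @ c \<in> S' \<and> {a \<in> tuples n. a @ c \<in> S'} \<subseteq> V}"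
proof -
  from assms obtain m' d B' S' where *: "definable M m' B'" "definable M (n + m') S'"
    "\<forall>c\<in>B'. openin T {a \<in> tuples n. a @ c \<in> S'}" "\<not> dim_ge m' (Suc d) B'"
    "\<forall>y\<in>Y. \<forall>V. openin T V \<longrightarrow> y \<in> V \<longrightarrow>
      dim_ge m' d {c \<in> B'. y @ c \<in> S' \<and> {a \<in> tuples n. a @ c \<in> S'} \<subseteq> V}"
    unfolding covered_def by (elim exE conjE)
  show thesis
    by (rule that[OF *(1,2) _ *(4)]) (use *(3,5) in simp_all)
qed

lemma covered_empty: "covered {}"
proof -
  have "definable M k {x \<in> tuples k. False}" for k
    by (intro definable_Collect definable_pred_const)
  then have "definable M k {}" for k
    by simp
  moreover have "\<not> dim_ge 0 (Suc 0) {}"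
    by simp
  ultimately show ?thesis
    by (intro coveredI[of 0 "{}" "{}" 0]) simp_all
qed

lemma covered_Un:
  assumes "covered Y1" "covered Y2" "Y1 \<subseteq> topspace T" "Y2 \<subseteq> topspace T"
  shows "covered (Y1 \<union> Y2)"
proof (cases "Y1 = {} \<or> Y2 = {}")
  case True
  then show ?thesis
    using assms(1,2) by auto
next
  case False
  then obtain y1 y2 where y: "y1 \<in> Y1" "y2 \<in> Y2"
    by blast
  obtain m1 d1 B1 S1 where B1: "definable M m1 B1" and S1: "definable M (n + m1) S1"
    and open1: "\<And>c. c \<in> B1 \<Longrightarrow> openin T {a \<in> tuples n. a @ c \<in> S1}"
    and dim1: "\<not> dim_ge m1 (Suc d1) B1"
    and cov1: "\<And>y V. y \<in> Y1 \<Longrightarrow> openin T V \<Longrightarrow> y \<in> V \<Longrightarrow>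
      dim_ge m1 d1 {c \<in> B1. y @ c \<in> S1 \<and> {a \<in> tuples n. a @ c \<in> S1} \<subseteq> V}"
    by (rule coveredE[OF assms(1)]) (rule that)
  obtain m2 d2 B2 S2 where B2: "definable M m2 B2" and S2: "definable M (n + m2) S2"
    and open2: "\<And>c. c \<in> B2 \<Longrightarrow> openin T {a \<in> tuples n. a @ c \<in> S2}"
    and dim2: "\<not> dim_ge m2 (Suc d2) B2"
    and cov2: "\<And>y V. y \<in> Y2 \<Longrightarrow> openin T V \<Longrightarrow> y \<in> V \<Longrightarrow>
      dim_ge m2 d2 {c \<in> B2. y @ c \<in> S2 \<and> {a \<in> tuples n. a @ c \<in> S2} \<subseteq> V}"
    by (rule coveredE[OF assms(2)]) (rule that)
  define prod where "prod A B = {a @ b |a b. a \<in> A \<and> b \<in> (B :: real list set)}"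
    for A B :: "real list set"
  \<comment> \<open>A point of \<open>Y1\<close> shows that \<open>B1\<close> really attains
    dimension \<open>d1\<close>, and likewise for \<open>B2\<close>. Without this a product with
    \<open>B1\<close> could have dimension too small.\<close>
  have full1: "dim_ge m1 d1 B1"
    by (rule dim_ge_mono[OF cov1[OF y(1) openin_topspace]]) (use y(1) assms(3) in auto)
  have full2: "dim_ge m2 d2 B2"
    by (rule dim_ge_mono[OF cov2[OF y(2) openin_topspace]]) (use y(2) assms(4) in auto)
  have len1: "length c = m1" if "c \<in> B1" for c
    using that definable_subset_tuples[OF B1] by (auto simp: tuples_def)
  have len2: "length c = m2" if "c \<in> B2" for c
    using that definable_subset_tuples[OF B2] by (auto simp: tuples_def)
  \<comment> \<open>The last coordinate of an index \<open>c1 @ c2 @ [t]\<close> says which of the two families is meant;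
    taking the product of the index sets makes their dimensions equal.\<close>
  define G :: "real list set" where "G = {[0]} \<union> {[1]}"
  have "definable M 1 {x \<in> tuples 1. x \<in> {[0]} \<or> x \<in> {[1]}}"
    by (intro definable_Collect definable_pred_disj definable_pred_mem[OF definable_singleton]
        definable_intros) simp_all
  moreover have "{x \<in> tuples 1. x \<in> {[0]} \<or> x \<in> {[1]}} = G"
    by (auto simp: G_def tuples_def)
  ultimately have G: "definable M 1 G"
    by simp
  define B' where "B' = prod (prod B1 B2) G"
  let ?N = "m1 + m2 + 1"
  have B': "definable M ?N B'"
    unfolding B'_def prod_def by (intro definable_product B1 B2 G)
  \<comment> \<open>An element is \<open>a @ c1 @ c2 @ [t]\<close>: the tail is the switch
    \<open>t\<close>, and \<open>a\<close> is tested against \<open>c1\<close> in \<open>S1\<close>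
    or against \<open>c2\<close> in \<open>S2\<close>.\<close>
  define S' where "S' = {x \<in> tuples (n + ?N).
    (drop (n + (m1 + m2)) x \<in> {[0]} \<and> take (n + m1) x \<in> S1) \<or>
    (drop (n + (m1 + m2)) x \<in> {[1]} \<and> take n x @ take m2 (drop (n + m1) x) \<in> S2)}"
  have S': "definable M (n + ?N) S'"
    unfolding S'_def
    by (intro definable_Collect definable_pred_disj definable_pred_conj
        definable_pred_mem[OF definable_singleton] definable_pred_mem[OF S1]
        definable_pred_mem[OF S2] definable_intros) simp_all
  have mem1: "a @ (c1 @ c2) @ [0] \<in> S' \<longleftrightarrow> a @ c1 \<in> S1"
    if "a \<in> tuples n" "c1 \<in> B1" "c2 \<in> B2" for a c1 c2
    using that(1) len1[OF that(2)] len2[OF that(3)] by (simp add: S'_def tuples_def)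
  have mem2: "a @ (c1 @ c2) @ [1] \<in> S' \<longleftrightarrow> a @ c2 \<in> S2"
    if "a \<in> tuples n" "c1 \<in> B1" "c2 \<in> B2" for a c1 c2
    using that(1) len1[OF that(2)] len2[OF that(3)] by (simp add: S'_def tuples_def)
  have fib1: "{a \<in> tuples n. a @ (c1 @ c2) @ [0] \<in> S'} = {a \<in> tuples n. a @ c1 \<in> S1}"
    if "c1 \<in> B1" "c2 \<in> B2" for c1 c2
    using mem1[OF _ that] by blast
  have fib2: "{a \<in> tuples n. a @ (c1 @ c2) @ [1] \<in> S'} = {a \<in> tuples n. a @ c2 \<in> S2}"
    if "c1 \<in> B1" "c2 \<in> B2" for c1 c2
    using mem2[OF _ that] by blast
  have dimG: "\<not> dim_ge 1 (Suc 0) G"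
  proof -
    have "{t. [t] \<in> G} = {0, 1}"
      by (auto simp: G_def)
    then show ?thesis
      using dim_ge_1[of "Suc 0" G] by simp
  qed
  have point: "dim_ge 1 0 {[c]}" for c
    by (simp add: dim_ge_0)
  have Y_tup: "y \<in> tuples n" if "y \<in> Y1 \<union> Y2" for y
    using that assms(3,4) topspace_eq by blast
  show ?thesis
  proof (rule coveredI[OF B' S'])
    fix c assume "c \<in> B'"
    then obtain c1 c2 g where c: "c = (c1 @ c2) @ g" "c1 \<in> B1" "c2 \<in> B2" "g \<in> G"
      unfolding B'_def prod_def by auto
    from c(4) show "openin T {a \<in> tuples n. a @ c \<in> S'}"
      unfolding G_def
    proof
      assume "g \<in> {[0]}"
      then show ?thesis
        using c(1) fib1[OF c(2,3)] open1[OF c(2)] by simp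
    next
      assume "g \<in> {[1]}"
      then show ?thesis
        using c(1) fib2[OF c(2,3)] open2[OF c(3)] by simp
    qed
  next
    have "prod B1 B2 \<subseteq> tuples (m1 + m2)"
      using len1 len2 by (auto simp: prod_def tuples_def)
    moreover have "\<not> dim_ge (m1 + m2) (Suc (d1 + d2)) (prod B1 B2)"
      unfolding prod_def by (rule not_dim_ge_product[OF definable_subset_tuples[OF B1] dim1 dim2])
    ultimately have "\<not> dim_ge ?N (Suc (d1 + d2 + 0)) B'"
      unfolding B'_def prod_def[of "prod B1 B2"] using dimG by (rule not_dim_ge_product)
    then show "\<not> dim_ge ?N (Suc (d1 + d2)) B'"
      by simp
  next
    fix y V assume V: "y \<in> Y1 \<union> Y2" "openin T V" "y \<in> V"
    let ?A = "{c \<in> B'. y @ c \<in> S' \<and> {a \<in> tuples n. a @ c \<in> S'} \<subseteq> V}"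
    have "dim_ge ?N (d1 + d2 + 0) ?A"
    proof (cases "y \<in> Y1")
      case True
      let ?A1 = "{c \<in> B1. y @ c \<in> S1 \<and> {a \<in> tuples n. a @ c \<in> S1} \<subseteq> V}"
      \<comment> \<open>The suitable indices in the first family, combined with all of
        \<open>B2\<close>, already have the dimension \<open>d1 + d2\<close> of the product.\<close>
      have "dim_ge ?N (d1 + d2 + 0) (prod (prod ?A1 B2) {[0]})"
        unfolding prod_def by (intro dim_ge_product cov1 True V full2 point)
      moreover have "prod (prod ?A1 B2) {[0]} \<subseteq> ?A"
      proof
        fix c assume "c \<in> prod (prod ?A1 B2) {[0]}"
        then obtain c1 c2 where c: "c = (c1 @ c2) @ [0]" "c1 \<in> ?A1" "c2 \<in> B2"
          unfolding prod_def by auto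
        then have "c1 \<in> B1"
          by blast
        moreover have "c \<in> B'"
          unfolding B'_def prod_def G_def using c \<open>c1 \<in> B1\<close> by blast
        ultimately show "c \<in> ?A"
          using c fib1[OF _ c(3)] mem1[OF Y_tup[OF V(1)] _ c(3)] by auto
      qed
      ultimately show ?thesis
        by (rule dim_ge_mono)
    next
      case False
      then have True: "y \<in> Y2"
        using V(1) by blast
      let ?A2 = "{c \<in> B2. y @ c \<in> S2 \<and> {a \<in> tuples n. a @ c \<in> S2} \<subseteq> V}"
      have "dim_ge ?N (d1 + d2 + 0) (prod (prod B1 ?A2) {[1]})"
        unfolding prod_def by (intro dim_ge_product cov2 True V full1 point)
      moreover have "prod (prod B1 ?A2) {[1]} \<subseteq> ?A"
      proof
        fix c assume "c \<in> prod (prod B1 ?A2) {[1]}"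
        then obtain c1 c2 where c: "c = (c1 @ c2) @ [1]" "c1 \<in> B1" "c2 \<in> ?A2"
          unfolding prod_def by auto
        then have "c2 \<in> B2"
          by blast
        moreover have "c \<in> B'"
          unfolding B'_def prod_def G_def using c \<open>c2 \<in> B2\<close> by blast
        ultimately show "c \<in> ?A"
          using c fib2[OF c(2)] mem2[OF Y_tup[OF V(1)] c(2)] by auto
      qed
      ultimately show ?thesis
        by (rule dim_ge_mono)
    qed
    then show "dim_ge ?N (d1 + d2) ?A"
      by simp
  qed
qed

lemma covered_UN:
  assumes "finite I" "\<And>i. i \<in> I \<Longrightarrow> covered (Y i)" "\<And>i. i \<in> I \<Longrightarrow> Y i \<subseteq> topspace T"
  shows "covered (\<Union>i\<in>I. Y i)"
  using assms
proof (induction rule: finite_induct)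
  case (insert i I)
  have "covered (Y i \<union> (\<Union>j\<in>I. Y j))"
    using insert by (intro covered_Un insert.IH UN_least) auto
  then show ?case
    by simp
qed (simp add: covered_empty)


section \<open>Decomposition of the space by local dimensions\<close>

text \<open>Inclusion between basic sets, kept as an explicit formula so that the definability rules
  apply after unfolding.\<close>

definition below :: "real list \<Rightarrow> real list \<Rightarrow> bool" where
  "below c b \<longleftrightarrow> (\<forall>a\<in>tuples n. a @ c \<in> S \<longrightarrow> a @ b \<in> S)"

lemma below_iff: "below c b \<longleftrightarrow> U c \<subseteq> U b"
  unfolding below_def by blast

text \<open>\<open>local_pred z b\<close> is the set \<open>A(z,b)\<close> of the introduction, \<open>minimal_pred k z\<close> is \<open>G\<^sub>z\<close>, and
  \<open>piece Y k g\<close> is the set of the \<open>z \<in> Y\<close> with minimum \<open>k\<close> and \<open>dim G\<^sub>z = g\<close>; the condition on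
  \<open>G\<^sub>z\<close> implies that the minimum is attained.\<close>

definition local_pred :: "real list \<Rightarrow> real list \<Rightarrow> real list \<Rightarrow> bool" where
  "local_pred z b c \<longleftrightarrow> c \<in> B \<and> z @ c \<in> S \<and> below c b"

definition minimal_pred :: "nat \<Rightarrow> real list \<Rightarrow> real list \<Rightarrow> bool" where
  "minimal_pred k z b \<longleftrightarrow>
     b \<in> B \<and> z @ b \<in> S \<and> \<not> dim_ge m (Suc k) {c \<in> tuples m. local_pred z b c}"

definition piece :: "real list set \<Rightarrow> nat \<Rightarrow> nat \<Rightarrow> real list set" where
  "piece Y k g = {z \<in> tuples n. z \<in> Y \<and>
     (\<forall>b\<in>B. z @ b \<in> S \<longrightarrow> dim_ge m k {c \<in> tuples m. local_pred z b c}) \<and>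
     dim_ge m g {b \<in> tuples m. minimal_pred k z b} \<and>
     \<not> dim_ge m (Suc g) {b \<in> tuples m. minimal_pred k z b}}"

lemma definable_piece:
  assumes Y: "definable M n Y"
  shows "definable M n (piece Y k g)"
  unfolding piece_def minimal_pred_def local_pred_def below_def
  by (intro definable_Collect definable_pred_ball[OF B] definable_pred_dim_ge definable_pred_mem[OF Y]
      definable_pred_mem[OF B] definable_pred_mem[OF S] definable_intros) simp_all

text \<open>Take \<open>k\<close> least such that some \<open>b\<close> has local dimension at most
  \<open>k\<close> at \<open>z\<close>. Minimality forces local dimension at least \<open>k\<close>
  at every \<open>b\<close>; for \<open>k = 0\<close> it suffices that \<open>b\<close> is below
  itself. Then let \<open>g\<close> be the dimension of the set of minimizers. Both numbers are at
  most \<open>m\<close>.\<close>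

lemma pieces_cover:
  assumes "Y \<subseteq> topspace T"
  shows "Y \<subseteq> (\<Union>kg\<in>{..m} \<times> {..m}. piece Y (fst kg) (snd kg))"
proof
  fix z assume z: "z \<in> Y"
  then have zt: "z \<in> tuples n" and ex: "\<exists>b\<in>B. z @ b \<in> S"
    using assms topspace_eq by auto
  let ?L = "\<lambda>b. {c \<in> tuples m. local_pred z b c}"
  define P where "P k \<longleftrightarrow> (\<exists>b\<in>B. z @ b \<in> S \<and> \<not> dim_ge m (Suc k) (?L b))" for k
  have "P m"
    using ex dim_ge_le[of m "Suc m"] unfolding P_def by fastforce
  define k where "k = (LEAST k. P k)"
  have "P k" "k \<le> m"
    unfolding k_def using \<open>P m\<close> by (auto intro: LeastI Least_le)
  have full: "dim_ge m k (?L b)" if b: "b \<in> B" "z @ b \<in> S" for b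
  proof (cases k)
    case 0
    have "b \<in> ?L b" "length b = m"
      using b B_length by (auto simp: local_pred_def below_def tuples_def)
    then show ?thesis
      unfolding 0 dim_ge_0 by blast
  next
    case (Suc j)
    then have "\<not> P j"
      using not_less_Least[of j P] unfolding k_def by simp
    then show ?thesis
      using b Suc unfolding P_def by blast
  qed
  let ?G = "{b \<in> tuples m. minimal_pred k z b}"
  obtain b where "b \<in> B" "z @ b \<in> S" "\<not> dim_ge m (Suc k) (?L b)"
    using \<open>P k\<close> unfolding P_def by blast
  then have "b \<in> ?G"
    using B_length by (simp add: minimal_pred_def tuples_def)
  then obtain g where g: "dim_ge m g ?G" "\<not> dim_ge m (Suc g) ?G"
    using dim_ge_exact[of ?G m] by blast
  have "g \<le> m"
    using dim_ge_le[OF g(1)] .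
  have "z \<in> piece Y k g"
    unfolding piece_def using zt z full g by simp
  then show "z \<in> (\<Union>kg\<in>{..m} \<times> {..m}. piece Y (fst kg) (snd kg))"
    using \<open>k \<le> m\<close> \<open>g \<le> m\<close> by (intro UN_I[of "(k, g)"]) auto
qed

section \<open>The family indexed by triples\<close>

definition triples :: "real list set \<Rightarrow> nat \<Rightarrow> real list set" where
  "triples Z k = {w \<in> tuples (n + (m + m)). take n w \<in> Z \<and>
     minimal_pred k (take n w) (take m (drop n w)) \<and>
     local_pred (take n w) (take m (drop n w)) (drop (n + m) w)}"

lemma definable_triples:
  assumes Z: "definable M n Z"
  shows "definable M (n + (m + m)) (triples Z k)"
  unfolding triples_def minimal_pred_def local_pred_def below_def
  by (intro definable_Collect definable_pred_dim_ge definable_pred_mem[OF Z]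
      definable_pred_mem[OF B] definable_pred_mem[OF S] definable_intros) simp_all

lemma triples_iff:
  assumes "length z = n" "length b = m"
  shows "z @ b @ c \<in> triples Z k \<longleftrightarrow> z \<in> Z \<and> minimal_pred k z b \<and> local_pred z b c"
  using assms B_length by (auto simp: triples_def tuples_def local_pred_def)

text \<open>Subadditivity twice: \<open>z\<close> ranges over dimension at most \<open>d\<close>,
  then \<open>b\<close> over at most \<open>g\<close>, and then \<open>c\<close> over at most
  \<open>k\<close>, because \<open>b\<close> is a minimizer.\<close>

lemma not_dim_ge_triples:
  assumes "\<not> dim_ge n (Suc d) Z"
    and g: "\<And>z. z \<in> Z \<Longrightarrow> \<not> dim_ge m (Suc g) {b \<in> tuples m. minimal_pred k z b}"
  shows "\<not> dim_ge (n + (m + m)) (Suc (d + (g + k))) (triples Z k)"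
proof
  assume "dim_ge (n + (m + m)) (Suc (d + (g + k))) (triples Z k)"
  then have "dim_ge (n + (m + m)) (Suc d + (g + k)) (triples Z k)"
    by simp
  then have "dim_ge n (Suc d) Z"
  proof (rule dim_ge_subadditive)
    fix z w assume zw: "length z = n" "z @ w \<in> triples Z k"
    have "take n (z @ w) \<in> Z"
      using zw(2) unfolding triples_def by blast
    then show "z \<in> Z"
      using zw(1) by simp
  next
    fix z assume z: "z \<in> Z" "length z = n"
    show "\<not> dim_ge (m + m) (Suc (g + k)) {w. z @ w \<in> triples Z k}"
    proof
      assume "dim_ge (m + m) (Suc (g + k)) {w. z @ w \<in> triples Z k}"
      then have "dim_ge (m + m) (Suc g + k) {w. z @ w \<in> triples Z k}"
        by simp
      then have "dim_ge m (Suc g) {b \<in> tuples m. minimal_pred k z b}"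
      proof (rule dim_ge_subadditive)
        fix b c assume "length b = m" "b @ c \<in> {w. z @ w \<in> triples Z k}"
        then show "b \<in> {b \<in> tuples m. minimal_pred k z b}"
          using triples_iff[OF z(2), of b c] by (simp add: tuples_def)
      next
        fix b assume b: "b \<in> {b \<in> tuples m. minimal_pred k z b}" "length b = m"
        have "{c. b @ c \<in> {w. z @ w \<in> triples Z k}} \<subseteq> {c \<in> tuples m. local_pred z b c}"
          using triples_iff[OF z(2) b(2)] B_length by (auto simp: local_pred_def tuples_def)
        moreover have "\<not> dim_ge m (Suc k) {c \<in> tuples m. local_pred z b c}"
          using b(1) unfolding minimal_pred_def by blast
        ultimately show "\<not> dim_ge m (Suc k) {c. b @ c \<in> {w. z @ w \<in> triples Z k}}"
          using dim_ge_mono by blast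
      qed
      then show False
        using g[OF z(1)] by blast
    qed
  qed
  then show False
    using assms(1) by blast
qed

text \<open>\<open>smaller\<close> is the induction hypothesis on the dimension. It takes care of
  \<open>bad\<close>, whose dimension is below \<open>d\<close>; the triples themselves cover the
  remaining points of the piece.\<close>

lemma covered_piece:
  assumes D: "countable D" "D \<subseteq> B" "basis_for T (U ` D)"
    and Y: "definable M n Y" "Y \<subseteq> topspace T" "\<not> dim_ge n (Suc d) Y"
    and smaller: "\<And>Y'. definable M n Y' \<Longrightarrow> Y' \<subseteq> topspace T \<Longrightarrow> \<not> dim_ge n d Y' \<Longrightarrow> covered Y'"
  shows "covered (piece Y k g)"
proof -
  define Z where "Z = piece Y k g"
  define N where "N = n + (m + m)"
  define q where "q = d + (g + k)"
  define W where "W = triples Z k"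
  define lastm where "lastm w = drop (n + m) w" for w :: "real list"
  \<comment> \<open>The triples whose neighbourhood contains \<open>y\<close> and lies in
    \<open>U b\<close>; their first component need not be \<open>y\<close>.\<close>
  define C where "C y b = {w \<in> tuples N. w \<in> W \<and> y @ lastm w \<in> S \<and> below (lastm w) b}" for y b
  define bad where "bad = {y \<in> tuples n. y \<in> Z \<and> (\<exists>b\<in>B. y @ b \<in> S \<and> \<not> dim_ge N q (C y b))}"
  have Z: "definable M n Z"
    unfolding Z_def by (rule definable_piece[OF Y(1)])
  have "Z \<subseteq> Y"
    unfolding Z_def piece_def by blast
  then have Z_top: "Z \<subseteq> topspace T"
    using Y(2) by blast
  have dimZ: "\<not> dim_ge n (Suc d) Z"
    using Y(3) dim_ge_mono \<open>Z \<subseteq> Y\<close> by blast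
  have Z_full: "dim_ge m k {c \<in> tuples m. local_pred z b c}" if "z \<in> Z" "b \<in> B" "z @ b \<in> S" for z b
    using that unfolding Z_def piece_def by blast
  have Z_min: "dim_ge m g {b \<in> tuples m. minimal_pred k z b}"
    "\<not> dim_ge m (Suc g) {b \<in> tuples m. minimal_pred k z b}" if "z \<in> Z" for z
    using that unfolding Z_def piece_def by blast+
  have W: "definable M N W"
    unfolding N_def W_def by (rule definable_triples[OF Z])
  have dimW: "\<not> dim_ge N (Suc q) W"
    unfolding N_def W_def q_def by (rule not_dim_ge_triples[OF dimZ Z_min(2)])
  have lastm_B: "lastm w \<in> B" and W_S: "take n w @ lastm w \<in> S" if "w \<in> W" for w
    using that unfolding W_def triples_def local_pred_def lastm_def by blast+
  have C_mono: "C y b \<subseteq> C y b'" if "below b b'" for y b b'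
    using that unfolding C_def below_iff by blast
  have bad: "definable M n bad"
    unfolding bad_def C_def below_def lastm_def
    by (intro definable_Collect definable_pred_bex[OF B] definable_pred_dim_ge definable_pred_mem[OF Z]
        definable_pred_mem[OF S] definable_pred_mem[OF W] definable_intros) (simp_all add: N_def)
  have small: "\<not> dim_ge n d bad"
  proof
    assume dim: "dim_ge n d bad"
    define bad_at where "bad_at b = {y \<in> Z. y @ b \<in> S \<and> \<not> dim_ge N q (C y b)}" for b
    \<comment> \<open>Shrinking \<open>U b\<close> to a basic set indexed by \<open>D\<close>
      shrinks \<open>C y b\<close>, so badness persists and countably many \<open>b\<close>
      suffice.\<close>
    have "bad \<subseteq> (\<Union>b\<in>D. bad_at b)"
    proof
      fix y assume "y \<in> bad"
      then obtain b where y: "y \<in> tuples n" "y \<in> Z" and b: "b \<in> B" "y @ b \<in> S" "\<not> dim_ge N q (C y b)"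
        unfolding bad_def by blast
      have "y \<in> U b"
        using y(1) b(2) by blast
      then obtain b' where b': "b' \<in> D" "y \<in> U b'" "U b' \<subseteq> U b"
        by (rule basis_for_nhd[OF D(3) U_open[OF b(1)]]) (rule that)
      have "C y b' \<subseteq> C y b"
        by (rule C_mono) (use b'(3) in \<open>simp add: below_iff\<close>)
      then have "y \<in> bad_at b'"
        using b(3) b'(2) y(2) dim_ge_mono unfolding bad_at_def by blast
      then show "y \<in> (\<Union>b\<in>D. bad_at b)"
        using b'(1) by blast
    qed
    then have "dim_ge n d (\<Union>b\<in>D. bad_at b)"
      by (rule dim_ge_mono[OF dim])
    then obtain b where b: "b \<in> D" "dim_ge n d (bad_at b)"
      using dim_ge_UN[OF D(1)] by blast
    then have bB: "b \<in> B"
      using D(2) by blast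
    define W' where "W' = {w \<in> W. take n w \<in> bad_at b \<and> below (lastm w) b}"
    have "dim_ge N q W'"
      unfolding N_def q_def
    proof (rule dim_ge_superadditive[OF b(2)])
      fix z assume z: "z \<in> bad_at b" "length z = n"
      then have zZ: "z \<in> Z"
        unfolding bad_at_def by blast
      show "dim_ge (m + m) (g + k) {w. z @ w \<in> W'}"
      proof (rule dim_ge_superadditive[OF Z_min(1)[OF zZ]])
        fix b0 assume b0: "b0 \<in> {b \<in> tuples m. minimal_pred k z b}" "length b0 = m"
        have "b0 \<in> B" "z \<in> U b0" "z \<in> U b"
          using z b0(1) unfolding bad_at_def minimal_pred_def tuples_def by auto
        \<comment> \<open>Choose a basic \<open>U b1\<close> around \<open>z\<close> in the
          intersection. Every index local to \<open>b1\<close> completes \<open>z @ b0\<close> to a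
          triple in \<open>W'\<close>, and there are \<open>k\<close> dimensions of them because
          \<open>k\<close> is the minimum at \<open>z\<close>.\<close>
        then have "openin T (U b0 \<inter> U b)" "z \<in> U b0 \<inter> U b"
          using openin_Int[OF U_open U_open, of b0 b] bB by simp_all
        then obtain b1 where b1: "b1 \<in> B" "z \<in> U b1" "U b1 \<subseteq> U b0 \<inter> U b"
          by (rule U_nhd) (rule that)
        have "{c \<in> tuples m. local_pred z b1 c} \<subseteq> {w. b0 @ w \<in> {w. z @ w \<in> W'}}"
        proof
          fix c assume "c \<in> {c \<in> tuples m. local_pred z b1 c}"
          then have c: "local_pred z b0 c" "below c b"
            using b1(3) unfolding local_pred_def below_iff by blast+
          then have "z @ b0 @ c \<in> W"
            unfolding W_def triples_iff[OF z(2) b0(2)] using zZ b0(1) by blast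
          then show "c \<in> {w. b0 @ w \<in> {w. z @ w \<in> W'}}"
            unfolding W'_def lastm_def using z b0(2) c(2) by simp
        qed
        then show "dim_ge m k {w. b0 @ w \<in> {w. z @ w \<in> W'}}"
          by (rule dim_ge_mono[rotated]) (use Z_full[OF zZ b1(1)] b1(2) in blast)
      qed
    qed
    \<comment> \<open>Each triple in \<open>W'\<close> has a set \<open>U c\<close> with
      \<open>c\<close> in \<open>D\<close> between its point and its neighbourhood. By the
      pigeonhole principle one \<open>c\<close> serves a set of triples of dimension
      \<open>q\<close>.\<close>
    define V where "V c = {w \<in> W'. take n w \<in> U c \<and> U c \<subseteq> U (lastm w)}" for c
    have "W' \<subseteq> (\<Union>c\<in>D. V c)"
    proof
      fix w assume w: "w \<in> W'"
      then have wW: "w \<in> W"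
        unfolding W'_def by blast
      then have "take n w \<in> tuples n"
        unfolding W_def triples_def tuples_def by auto
      then have "take n w \<in> U (lastm w)"
        using W_S[OF wW] by blast
      then obtain c where "c \<in> D" "take n w \<in> U c" "U c \<subseteq> U (lastm w)"
        by (rule basis_for_nhd[OF D(3) U_open[OF lastm_B[OF wW]]]) (rule that)
      then show "w \<in> (\<Union>c\<in>D. V c)"
        using w unfolding V_def by blast
    qed
    then have "dim_ge N q (\<Union>c\<in>D. V c)"
      by (rule dim_ge_mono[OF \<open>dim_ge N q W'\<close>])
    then obtain c where c: "c \<in> D" "dim_ge N q (V c)"
      using dim_ge_UN[OF D(1)] by blast
    obtain w0 where w0: "w0 \<in> V c"
      using dim_ge_nonempty[OF c(2)] by blast
    define z0 where "z0 = take n w0"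
    have z0: "z0 \<in> bad_at b" "z0 \<in> U c"
      using w0 unfolding z0_def V_def W'_def by blast+
    \<comment> \<open>The common set \<open>U c\<close> contains \<open>z0\<close> and lies in the
      neighbourhood of every triple in \<open>V c\<close>. Hence all these triples count for the
      single point \<open>z0\<close>, which contradicts its badness at \<open>b\<close>.\<close>
    have "V c \<subseteq> C z0 b"
    proof
      fix w assume w: "w \<in> V c"
      then have "w \<in> W" "below (lastm w) b" "z0 @ lastm w \<in> S"
        using z0(2) unfolding V_def W'_def by blast+
      moreover have "w \<in> tuples N"
        using \<open>w \<in> W\<close> definable_subset_tuples[OF W] by blast
      ultimately show "w \<in> C z0 b"
        unfolding C_def by blast
    qed
    then have "dim_ge N q (C z0 b)"
      by (rule dim_ge_mono[OF c(2)])
    then show False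
      using z0(1) unfolding bad_at_def by blast
  qed
  have "bad \<subseteq> topspace T"
    using Z_top unfolding bad_def by blast
  then have "covered bad"
    by (intro smaller bad small)
  moreover have "covered (Z - bad)"
  proof -
    \<comment> \<open>An element is \<open>a @ z @ b @ c\<close>; only \<open>c\<close> names the
      neighbourhood, so \<open>z\<close> and \<open>b\<close> are skipped.\<close>
    define S' where "S' = {x \<in> tuples (n + N). take n x @ drop (n + (n + m)) x \<in> S}"
    have S': "definable M (n + N) S'"
      unfolding S'_def
      by (intro definable_Collect definable_pred_mem[OF S] definable_intros) (simp add: N_def)
    have mem: "a @ w \<in> S' \<longleftrightarrow> a @ lastm w \<in> S" if "a \<in> tuples n" "w \<in> W" for a w
      using that definable_subset_tuples[OF W] by (auto simp: S'_def lastm_def tuples_def add.assoc)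
    have fib: "{a \<in> tuples n. a @ w \<in> S'} = U (lastm w)" if "w \<in> W" for w
      using mem[OF _ that] by blast
    show ?thesis
    proof (rule coveredI[OF W S' _ dimW])
      show "openin T {a \<in> tuples n. a @ w \<in> S'}" if "w \<in> W" for w
        unfolding fib[OF that] by (rule U_open[OF lastm_B[OF that]])
      fix y V assume y: "y \<in> Z - bad" and V: "openin T V" "y \<in> V"
      have yt: "y \<in> tuples n"
        using y Z_top topspace_eq by blast
      obtain b where b: "b \<in> B" "y \<in> U b" "U b \<subseteq> V"
        by (rule U_nhd[OF V]) (rule that)
      then have "dim_ge N q (C y b)"
        using y yt unfolding bad_def by blast
      moreover have "C y b \<subseteq> {w \<in> W. y @ w \<in> S' \<and> {a \<in> tuples n. a @ w \<in> S'} \<subseteq> V}"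
      proof
        fix w assume "w \<in> C y b"
        then have w: "w \<in> W" "y @ lastm w \<in> S" "U (lastm w) \<subseteq> U b"
          unfolding C_def below_iff by blast+
        then show "w \<in> {w \<in> W. y @ w \<in> S' \<and> {a \<in> tuples n. a @ w \<in> S'} \<subseteq> V}"
          using mem[OF yt w(1)] fib[OF w(1)] b(3) by simp
      qed
      ultimately show "dim_ge N q {w \<in> W. y @ w \<in> S' \<and> {a \<in> tuples n. a @ w \<in> S'} \<subseteq> V}"
        by (rule dim_ge_mono)
    qed
  qed
  ultimately have "covered (bad \<union> (Z - bad))"
    using Z_top \<open>bad \<subseteq> topspace T\<close> by (intro covered_Un) auto
  moreover have "bad \<union> (Z - bad) = Z"
    unfolding bad_def by blast
  ultimately show ?thesis
    unfolding Z_def by simp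
qed

section \<open>From a countable basis to definable second countability\<close>

lemma covered_if_second_countable:
  assumes "second_countable T"
  shows "covered (topspace T)"
proof -
  obtain D where D: "countable D" "D \<subseteq> B" "basis_for T (U ` D)"
    by (rule second_countable_subbasis[OF assms basis]) (rule that)
  \<comment> \<open>Here \<open>d\<close> is a strict upper bound for the dimension: for
    \<open>d = 0\<close> the set \<open>Y\<close> is empty, and \<open>Suc n\<close> applies to the
    whole space.\<close>
  have "covered Y" if "definable M n Y" "Y \<subseteq> topspace T" "\<not> dim_ge n d Y" for d Y
    using that
  proof (induction d arbitrary: Y)
    case 0
    have "Y = {}"
      using 0(1,3) definable_subset_tuples[OF 0(1)] unfolding dim_ge_0 tuples_def by blast
    then show ?case
      by (simp add: covered_empty)
  next
    case (Suc d)
    have "covered (\<Union>kg\<in>{..m} \<times> {..m}. piece Y (fst kg) (snd kg))"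
    proof (rule covered_UN)
      show "covered (piece Y (fst kg) (snd kg))" for kg
        by (rule covered_piece[OF D Suc.prems Suc.IH])
      show "piece Y (fst kg) (snd kg) \<subseteq> topspace T" for kg
        using Suc.prems(2) unfolding piece_def by blast
    qed simp
    moreover have "(\<Union>kg\<in>{..m} \<times> {..m}. piece Y (fst kg) (snd kg)) = Y"
      using pieces_cover[OF Suc.prems(2)] unfolding piece_def by blast
    ultimately show ?case
      by simp
  qed
  from this[OF definable_topspace, of "Suc n"] show ?thesis
    using dim_ge_le[of n "Suc n" "topspace T"] by auto
qed

lemma definably_second_countable_if:
  assumes "second_countable T"
  shows "definably_second_countable M n T"
proof -
  obtain m' d B' S' where B': "definable M m' B'" and S': "definable M (n + m') S'"
    and op: "\<And>c. c \<in> B' \<Longrightarrow> openin T {a \<in> tuples n. a @ c \<in> S'}" and dim: "\<not> dim_ge m' (Suc d) B'"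
    and cov: "\<And>y V. y \<in> topspace T \<Longrightarrow> openin T V \<Longrightarrow> y \<in> V \<Longrightarrow>
      dim_ge m' d {c \<in> B'. y @ c \<in> S' \<and> {a \<in> tuples n. a @ c \<in> S'} \<subseteq> V}"
    by (rule coveredE[OF covered_if_second_countable[OF assms]]) (rule that)
  define U' where "U' c = {a \<in> tuples n. a @ c \<in> S'}" for c
  have tup: "x \<in> tuples n" if "x \<in> topspace T" for x
    using that topspace_eq by blast
  have cov': "dim_ge m' d {c \<in> B'. y \<in> U' c \<and> U' c \<subseteq> V}" if V: "openin T V" "y \<in> V" for y V
  proof -
    have y: "y \<in> topspace T"
      using V openin_subset by blast
    show ?thesis
      using cov[OF y V] tup[OF y] unfolding U'_def by simp
  qed
  have "basis_for T (U' ` B')"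
    unfolding basis_for_def
  proof (intro conjI ballI allI impI)
    show "openin T V" if "V \<in> U' ` B'" for V
      using that op unfolding U'_def by blast
    fix W x assume "openin T W \<and> x \<in> W"
    then have "dim_ge m' d {c \<in> B'. x \<in> U' c \<and> U' c \<subseteq> W}"
      using cov' by blast
    \<comment> \<open>A set of indices of dimension at least \<open>d\<close> is nonempty, so the
      dimension condition already yields the basis property.\<close>
    from dim_ge_nonempty[OF this] show "\<exists>V\<in>U' ` B'. x \<in> V \<and> V \<subseteq> W"
      by blast
  qed
  moreover have "definable_family M n m' B' U'"
    unfolding definable_family_iff using B' S' U'_def by blast
  ultimately have "definable_basis M n T m' B' U'"
    unfolding definable_basis_def by blast
  moreover have "odim M {c \<in> B'. x \<in> U' c \<and> U' c \<subseteq> U' b} = odim M B'"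
    if x: "x \<in> topspace T" "b \<in> B'" "x \<in> U' b" for x b
  proof -
    let ?A = "{c \<in> B'. x \<in> U' c \<and> U' c \<subseteq> U' b}"
    have len: "length x = n" "length b = m'"
      using tup[OF x(1)] x(2) definable_subset_tuples[OF B'] by (auto simp: tuples_def)
    have "definable M m' {c \<in> tuples m'. c \<in> B' \<and> x @ c \<in> S' \<and>
        (\<forall>a\<in>tuples n. a @ c \<in> S' \<longrightarrow> a @ b \<in> S')}"
      by (intro definable_Collect definable_pred_mem[OF B'] definable_pred_mem[OF S'] definable_intros)
        (simp_all add: len)
    also have "{c \<in> tuples m'. c \<in> B' \<and> x @ c \<in> S' \<and>
        (\<forall>a\<in>tuples n. a @ c \<in> S' \<longrightarrow> a @ b \<in> S')} = ?A"
      using definable_subset_tuples[OF B'] tup[OF x(1)] unfolding U'_def by blast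
    finally have A: "definable M m' ?A" .
    \<comment> \<open>With the open set \<open>U' b\<close> itself as neighbourhood,
      \<open>?A\<close> and \<open>B'\<close> both have dimension exactly \<open>d\<close>.\<close>
    have "dim_ge m' d ?A"
      by (rule cov') (use x op in \<open>simp_all add: U'_def\<close>)
    then have "ereal (real d) \<le> odim M ?A" "ereal (real d) \<le> odim M B'"
      using odim_ge[OF A] odim_ge[OF B'] dim_ge_mono[of m' d ?A B'] by blast+
    moreover have "\<not> dim_ge m' (Suc d) ?A"
      using dim dim_ge_mono[of m' "Suc d" ?A B'] by blast
    then have "odim M ?A \<le> ereal (real d)" "odim M B' \<le> ereal (real d)"
      using odim_le[OF definable_subset_tuples[OF A]] odim_le[OF definable_subset_tuples[OF B'] dim]
      by blast+
    ultimately show ?thesis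
      by simp
  qed
  ultimately show ?thesis
    unfolding definably_second_countable_def by blast
qed

end

theorem theorem4p11:
  fixes M :: "('f, 'r, real) fo_structure"
    and n :: nat
    and T :: "real list topology"
  assumes "o_minimal_expansion M"
    and "definable_topological_space M n T"
  shows "definably_second_countable M n T \<longleftrightarrow> second_countable T"
proof
  interpret o_minimal M
    by unfold_locales (rule assms(1))
  show "second_countable T" if "definably_second_countable M n T"
    using that by (rule definably_second_countable_imp)
  obtain m B U where basis: "definable_basis M n T m B U"
    using assms(2) unfolding definable_topological_space_def by blast
  then obtain S where B: "definable M m B" and S: "definable M (n + m) S"
    and U: "\<forall>b\<in>B. U b = {a \<in> tuples n. a @ b \<in> S}"
    unfolding definable_basis_def definable_family_iff by blast
  have "U ` B = (\<lambda>b. {a \<in> tuples n. a @ b \<in> S}) ` B"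
    using U by (intro image_cong) auto
  then have "basis_for T ((\<lambda>b. {a \<in> tuples n. a @ b \<in> S}) ` B)"
    using basis unfolding definable_basis_def by simp
  then interpret definable_space M n m T B S
    using B S by unfold_locales
  show "definably_second_countable M n T" if "second_countable T"
    using that by (rule definably_second_countable_if)
qed

end
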